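(* Let $n$ be a positive integer. Then (1) there is a bijection between $(\mathcal{NG}\text{-}1\setminus\mathcal{NG}\text{-}2)_n$ and $\mathcal{T}_{\le n-2}$; and (2) there is a bijection between $(\mathcal{NG}\text{-}3)_n$ and $\mathcal{T}_{\le n-5}$.
   Context: All graphs are finite, simple and unlabeled (considered up to isomorphism). For a class $\mathcal{C}$, $\mathcal{C}_k$ denotes the set of graphs in $\mathcal{C}$ with $k$ vertices. $\chi$ is chromatic number, $\overline{G}$ the complement. $G$ is an NG-graph if $\chi(G)+\chi(\overline{G})=|V(G)|+1$; its ABC-partition is $A=\{v:\deg(v)=\chi(G)-1\}$, $B=\{v:\deg(v)>\chi(G)-1\}$, $C=\{v:\deg(v)<\chi(G)-1\}$. $\mathcal{NG}\text{-}1$, $\mathcal{NG}\text{-}2$, $\mathcal{NG}\text{-}3$ are the sets of NG-graphs with $G[A]$ a clique, a stable set, a 5-cycle, respectively. $\mathcal{S}$ is the set of split graphs (graphs whose vertex set partitions into a clique and a stable set), with $\mathcal{S}_0$ consisting of the single graph on $0$ vertices; $\mathcal{T}_{\le k}=\mathcal{S}_0\cup\cdots\cup\mathcal{S}_k$ is the set of split graphs with at most $k$ vertices (empty if $k<0$). *)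

theory Defs
  imports Main
begin

(* A graph is a pair of a vertex set and a set of two-element subsets of it. *)
type_synonym 'a sgraph = "'a set \<times> 'a set set"

abbreviation verts :: "'a sgraph \<Rightarrow> 'a set" where "verts \<equiv> fst"

abbreviation edges :: "'a sgraph \<Rightarrow> 'a set set" where "edges \<equiv> snd"

definition simple_graph :: "'a sgraph \<Rightarrow> bool" where
  "simple_graph G \<longleftrightarrow> finite (verts G) \<and> edges G \<subseteq> {e. e \<subseteq> verts G \<and> card e = 2}"

definition adjacent :: "'a sgraph \<Rightarrow> 'a \<Rightarrow> 'a \<Rightarrow> bool" where
  "adjacent G u v \<longleftrightarrow> {u, v} \<in> edges G"

definition graph_complement :: "'a sgraph \<Rightarrow> 'a sgraph" where
  "graph_complement G = (verts G, {e. e \<subseteq> verts G \<and> card e = 2} - edges G)"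

definition induced :: "'a sgraph \<Rightarrow> 'a set \<Rightarrow> 'a sgraph" where
  "induced G X = (X, {e \<in> edges G. e \<subseteq> X})"

definition vdegree :: "'a sgraph \<Rightarrow> 'a \<Rightarrow> nat" where
  "vdegree G v = card {u \<in> verts G. adjacent G u v}"

definition isomorphic :: "'a sgraph \<Rightarrow> 'b sgraph \<Rightarrow> bool" where
  "isomorphic G H \<longleftrightarrow> (\<exists>f. bij_betw f (verts G) (verts H) \<and>
     (\<forall>u\<in>verts G. \<forall>v\<in>verts G. adjacent G u v \<longleftrightarrow> adjacent H (f u) (f v)))"

definition complete_graph :: "'a sgraph \<Rightarrow> bool" where
  "complete_graph G \<longleftrightarrow> (\<forall>u\<in>verts G. \<forall>v\<in>verts G. u \<noteq> v \<longrightarrow> adjacent G u v)"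

definition edgeless_graph :: "'a sgraph \<Rightarrow> bool" where
  "edgeless_graph G \<longleftrightarrow> (\<forall>u\<in>verts G. \<forall>v\<in>verts G. \<not> adjacent G u v)"

definition cycle_graph :: "nat \<Rightarrow> nat sgraph" where
  "cycle_graph m = ({..<m}, {{i, Suc i mod m} | i. i < m})"

definition colorable :: "'a sgraph \<Rightarrow> nat \<Rightarrow> bool" where
  "colorable G k \<longleftrightarrow> (\<exists>c :: 'a \<Rightarrow> nat. c ` verts G \<subseteq> {..<k} \<and>
     (\<forall>u\<in>verts G. \<forall>v\<in>verts G. adjacent G u v \<longrightarrow> c u \<noteq> c v))"

definition chromatic_number :: "'a sgraph \<Rightarrow> nat" where
  "chromatic_number G = (LEAST k. colorable G k)"

definition NG_graph :: "'a sgraph \<Rightarrow> bool" where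
  "NG_graph G \<longleftrightarrow>
     chromatic_number G + chromatic_number (graph_complement G) = card (verts G) + 1"

(* The part A of the ABC-partition; the condition deg(v) = chi(G) - 1 is written
   without subtraction on the natural numbers. *)
definition A_part :: "'a sgraph \<Rightarrow> 'a set" where
  "A_part G = {v \<in> verts G. vdegree G v + 1 = chromatic_number G}"

(* Either part may be empty; in particular the graph without vertices is split. *)
definition split_graph :: "'a sgraph \<Rightarrow> bool" where
  "split_graph G \<longleftrightarrow> (\<exists>K S. K \<union> S = verts G \<and> K \<inter> S = {} \<and>
     complete_graph (induced G K) \<and> edgeless_graph (induced G S))"

(* An unlabeled graph is an isomorphism class of finite simple graphs. Every finite
   graph has a copy with vertices in nat, so this vertex type loses nothing. *)
definition iso_rel :: "nat sgraph rel" where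
  "iso_rel = {(G, H). simple_graph G \<and> simple_graph H \<and> isomorphic G H}"

type_synonym ugraph = "nat sgraph set"

definition unlabeled :: "(nat sgraph \<Rightarrow> bool) \<Rightarrow> ugraph set" where
  "unlabeled P = {G. simple_graph G \<and> P G} // iso_rel"

definition of_order :: "ugraph set \<Rightarrow> nat \<Rightarrow> ugraph set" where
  "of_order \<C> k = {\<G> \<in> \<C>. \<forall>G\<in>\<G>. card (verts G) = k}"

definition NG1 :: "ugraph set" where
  "NG1 = unlabeled (\<lambda>G. NG_graph G \<and> complete_graph (induced G (A_part G)))"

definition NG2 :: "ugraph set" where
  "NG2 = unlabeled (\<lambda>G. NG_graph G \<and> edgeless_graph (induced G (A_part G)))"

definition NG3 :: "ugraph set" where
  "NG3 = unlabeled (\<lambda>G. NG_graph G \<and> isomorphic (induced G (A_part G)) (cycle_graph 5))"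

definition Split :: "ugraph set" where
  "Split = unlabeled split_graph"

(* The bound is an integer, so that the set is empty for a negative bound. *)
definition Split_upto :: "int \<Rightarrow> ugraph set" where
  "Split_upto k = (\<Union>i\<in>{i. int i \<le> k}. of_order Split i)"

lemma isomorphic_refl: "isomorphic G G"
  unfolding isomorphic_def by (rule exI[of _ id]) simp

lemma isomorphic_sym:
  assumes "isomorphic G H"
  shows "isomorphic H G"
proof -
  obtain f where f: "bij_betw f (verts G) (verts H)"
    and e: "\<And>u v. u \<in> verts G \<Longrightarrow> v \<in> verts G \<Longrightarrow> adjacent G u v \<longleftrightarrow> adjacent H (f u) (f v)"
    using assms unfolding isomorphic_def by blast
  let ?g = "inv_into (verts G) f"
  have g: "bij_betw ?g (verts H) (verts G)"
    using f by (rule bij_betw_inv_into)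
  have "adjacent H u v \<longleftrightarrow> adjacent G (?g u) (?g v)"
    if "u \<in> verts H" "v \<in> verts H" for u v
    using e[of "?g u" "?g v"] that bij_betwE[OF g] bij_betw_inv_into_right[OF f] by simp
  with g show ?thesis
    unfolding isomorphic_def by blast
qed

lemma isomorphic_trans:
  assumes "isomorphic G H" and "isomorphic H K"
  shows "isomorphic G K"
proof -
  obtain f where f: "bij_betw f (verts G) (verts H)"
    and e: "\<And>u v. u \<in> verts G \<Longrightarrow> v \<in> verts G \<Longrightarrow> adjacent G u v \<longleftrightarrow> adjacent H (f u) (f v)"
    using assms(1) unfolding isomorphic_def by blast
  obtain g where g: "bij_betw g (verts H) (verts K)"
    and e': "\<And>u v. u \<in> verts H \<Longrightarrow> v \<in> verts H \<Longrightarrow> adjacent H u v \<longleftrightarrow> adjacent K (g u) (g v)"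
    using assms(2) unfolding isomorphic_def by blast
  have "bij_betw (g \<circ> f) (verts G) (verts K)"
    using f g by (rule bij_betw_trans)
  moreover have "adjacent G u v \<longleftrightarrow> adjacent K ((g \<circ> f) u) ((g \<circ> f) v)"
    if "u \<in> verts G" "v \<in> verts G" for u v
    using e e' that bij_betwE[OF f] by simp
  ultimately show ?thesis
    unfolding isomorphic_def by blast
qed

lemma equiv_iso_rel: "equiv {G. simple_graph G} iso_rel"
  by (rule equivI)
    (auto simp: iso_rel_def refl_on_def intro!: symI transI
      intro: isomorphic_refl isomorphic_sym isomorphic_trans)

lemma iso_rel_card: "(G, H) \<in> iso_rel \<Longrightarrow> card (verts G) = card (verts H)"
  by (auto simp: iso_rel_def isomorphic_def bij_betw_same_card)

end

(*
  In an NG-graph the vertices of low degree (C) are stable and see nothing of A, and dually those of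
  high degree (B) form a clique joined to A: deleting two adjacent offenders one after the other would
  keep the chromatic number while the complement saves a colour, against the Nordhaus-Gaddum bound for
  the rest. Hence G is determined by G[A] and the split graph G[B Un C] with its partition (B, C).
  Put the vertices of B without neighbours in C aside, and in the clique case all but two vertices of
  A. What is left of B Un C is a split graph in which every vertex of the clique side has a neighbour
  on the stable side; each split graph has such a partition, and it is unique up to automorphism.
  The only remaining freedom is the number of vertices put aside, which is fixed by the order n.
*)
theory Submission
  imports Defs
begin

text \<open>A vertex of B without neighbours in C must not stay in the split part: it could be moved
  to the stable side there, and non-isomorphic NG-graphs would leave the same split graph. Asking
  every clique vertex for a neighbour on the stable side removes this ambiguity. What remains is
  harmless, because a clique and a stable set share at most one vertex, so two such partitions
  differ by at most one exchange. If A has at most one vertex, G[A] is both a clique and stable;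
  taking away NG-2 leaves the cliques A with at least two vertices. Two are also what the degrees
  require: around a core of one vertex, a stable vertex joined to the whole clique side would have
  degree chi(G) - 1 and fall into A. So the shifts 2 and 5 are the orders of the cores. Where the
  vertices put aside end up is decided by the core. In the clique case chi(G) is the size of A plus
  that of B, so a vertex joined to just these has degree chi(G) - 1 and lies in A. Beside a 5-cycle,
  whose chromatic number 3 is below its order, it lies in B.\<close>

section \<open>Chromatic numbers and the Nordhaus-Gaddum bound\<close>

text \<open>Only distinct pairs matter, so that \<open>\<lambda>u v. \<not> E u v\<close> serves as the complement relation.\<close>

definition proper :: "'a set \<Rightarrow> ('a \<Rightarrow> 'a \<Rightarrow> bool) \<Rightarrow> ('a \<Rightarrow> nat) \<Rightarrow> bool" where
  "proper V E c \<longleftrightarrow> (\<forall>u\<in>V. \<forall>v\<in>V. u \<noteq> v \<longrightarrow> E u v \<longrightarrow> c u \<noteq> c v)"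

text \<open>Counting the values used, instead of prescribing a palette \<open>{..<k}\<close>, lets
  colourings be restricted, extended and recoloured without renumbering.\<close>

definition chi :: "'a set \<Rightarrow> ('a \<Rightarrow> 'a \<Rightarrow> bool) \<Rightarrow> nat" where
  "chi V E = (LEAST k. \<exists>c. proper V E c \<and> card (c ` V) \<le> k)"

definition deg :: "'a set \<Rightarrow> ('a \<Rightarrow> 'a \<Rightarrow> bool) \<Rightarrow> 'a \<Rightarrow> nat" where
  "deg V E v = card {u \<in> V. u \<noteq> v \<and> E u v}"

lemma proper_mono: "proper V E c \<Longrightarrow> W \<subseteq> V \<Longrightarrow> proper W E c"
  by (auto simp: proper_def)

lemma chi_le: "proper V E c \<Longrightarrow> card (c ` V) \<le> k \<Longrightarrow> chi V E \<le> k"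
  unfolding chi_def by (rule Least_le) blast

lemma chi_cong:
  assumes "\<And>u v. u \<in> V \<Longrightarrow> v \<in> V \<Longrightarrow> u \<noteq> v \<Longrightarrow> E u v \<longleftrightarrow> F u v"
  shows "chi V E = chi V F"
proof -
  have "proper V E = proper V F"
    using assms by (auto simp: proper_def fun_eq_iff)
  then show ?thesis by (simp add: chi_def)
qed

lemma deg_cong:
  assumes "\<And>u. u \<in> V \<Longrightarrow> u \<noteq> v \<Longrightarrow> E u v \<longleftrightarrow> F u v"
  shows "deg V E v = deg V F v"
  unfolding deg_def using assms by (intro arg_cong[where f = card]) auto

lemma chi_attained:
  assumes "finite V"
  obtains c where "proper V E c" "card (c ` V) = chi V E"
proof -
  obtain f :: "'a \<Rightarrow> nat" where "inj_on f V"
    using assms finite_imp_inj_to_nat_seg by blast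
  then have "proper V E f"
    by (auto simp: proper_def inj_on_def)
  then have "\<exists>c. proper V E c \<and> card (c ` V) \<le> card (f ` V)" by blast
  then have "\<exists>c. proper V E c \<and> card (c ` V) \<le> chi V E"
    unfolding chi_def by (rule LeastI)
  with that show ?thesis
    by (meson chi_le le_antisym order_refl)
qed

lemma chi_mono:
  assumes "finite V" "W \<subseteq> V"
  shows "chi W E \<le> chi V E"
proof -
  obtain c where c: "proper V E c" "card (c ` V) = chi V E"
    using assms(1) by (rule chi_attained)
  have "card (c ` W) \<le> card (c ` V)"
    using assms by (intro card_mono) auto
  with c assms show ?thesis
    by (metis chi_le proper_mono)
qed

lemma chi_Un_stable:
  assumes "finite V" "finite X" "\<And>u v. u \<in> X \<Longrightarrow> v \<in> X \<Longrightarrow> u \<noteq> v \<Longrightarrow> \<not> E u v"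
  shows "chi (V \<union> X) E \<le> chi V E + 1"
proof -
  obtain c where c: "proper V E c" "card (c ` V) = chi V E"
    using assms(1) by (rule chi_attained)
  obtain m where m: "m \<notin> c ` V"
    using assms(1) by (meson ex_new_if_finite finite_imageI infinite_UNIV_nat)
  let ?d = "\<lambda>v. if v \<in> X then m else c v"
  have "proper (V \<union> X) E ?d"
    using c(1) m assms(3) by (fastforce simp: proper_def)
  moreover have "card (?d ` (V \<union> X)) \<le> card (insert m (c ` V))"
    using assms by (intro card_mono) auto
  moreover have "card (insert m (c ` V)) = chi V E + 1"
    using m c(2) assms(1) by simp
  ultimately show ?thesis by (metis chi_le)
qed

lemma chi_Un_card:
  assumes "finite V" "finite X"
  shows "chi (V \<union> X) E \<le> chi V E + card X"
  using assms(2)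
proof induction
  case (insert x X)
  have "chi ((V \<union> X) \<union> {x}) E \<le> chi (V \<union> X) E + 1"
    using assms insert by (intro chi_Un_stable) auto
  with insert show ?case by simp
qed simp

text \<open>If the chromatic number dropped, it would drop by one only and still exceed the degree
  of \<open>v\<close>. An optimal colouring of the rest would then use a colour absent from the
  neighbours of \<open>v\<close>, which \<open>v\<close> could take.\<close>

lemma chi_remove_vertex:
  assumes "finite V" "v \<in> V" "symp E" "deg V E v + 1 < chi V E"
  shows "chi (V - {v}) E = chi V E"
proof (rule ccontr)
  let ?W = "V - {v}"
  assume ne: "chi ?W E \<noteq> chi V E"
  have "chi ?W E \<le> chi V E" using assms by (intro chi_mono) auto
  with ne have less: "chi ?W E < chi V E" by simp
  have "chi (?W \<union> {v}) E \<le> chi ?W E + card {v}"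
    using assms by (intro chi_Un_card) auto
  moreover have "?W \<union> {v} = V" using assms by auto
  ultimately have dW: "deg V E v < chi ?W E" using assms(4) by simp
  have "finite ?W" using assms by simp
  then obtain c where c: "proper ?W E c" "card (c ` ?W) = chi ?W E"
    by (rule chi_attained)
  let ?N = "{u \<in> V. u \<noteq> v \<and> E u v}"
  have "card (c ` ?N) < card (c ` ?W)"
    using card_image_le[of ?N c] assms(1) dW c(2) by (simp add: deg_def)
  moreover have "finite (c ` ?N)" using assms(1) by simp
  ultimately have "\<not> c ` ?W \<subseteq> c ` ?N"
    by (meson card_mono leD)
  then obtain m where m: "m \<in> c ` ?W" "m \<notin> c ` ?N" by blast
  let ?d = "c(v := m)"
  have "proper V E ?d"
    using c(1) m(2) \<open>symp E\<close> by (fastforce simp: proper_def symp_def)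
  moreover have "card (?d ` V) \<le> card (c ` ?W)"
    using assms(1) m(1) by (intro card_mono) auto
  ultimately have "chi V E \<le> chi ?W E" using c(2) by (metis chi_le)
  with less show False by simp
qed

lemma deg_complement:
  assumes "finite V" "v \<in> V"
  shows "deg V E v + deg V (\<lambda>u w. \<not> E u w) v + 1 = card V"
proof -
  have "deg V E v + deg V (\<lambda>u w. \<not> E u w) v
      = card ({u \<in> V. u \<noteq> v \<and> E u v} \<union> {u \<in> V. u \<noteq> v \<and> \<not> E u v})"
    unfolding deg_def using assms by (intro card_Un_disjoint[symmetric]) auto
  also have "{u \<in> V. u \<noteq> v \<and> E u v} \<union> {u \<in> V. u \<noteq> v \<and> \<not> E u v} = V - {v}" by auto
  finally show ?thesis
    using card_Suc_Diff1[OF assms] by simp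
qed

lemma chi_empty: "chi {} E = 0"
proof -
  have "chi {} E \<le> 0" by (rule chi_le[of _ _ "\<lambda>_. 0"]) (auto simp: proper_def)
  then show ?thesis by simp
qed

text \<open>If \<open>x\<close> has small degree in the graph or in the complement, that chromatic
  number survives the deletion of \<open>x\<close> and the other one changes by at most one.
  Otherwise both are at most degree plus one, and the two degrees of \<open>x\<close> add up to the
  number of other vertices.\<close>

theorem nordhaus_gaddum:
  assumes "finite V" "symp E"
  shows "chi V E + chi V (\<lambda>u v. \<not> E u v) \<le> card V + 1"
  using assms(1)
proof induction
  case empty
  show ?case by (simp add: chi_empty)
next
  case (insert x V)
  let ?E' = "\<lambda>u v. \<not> E u v" and ?V = "insert x V"
  have sym': "symp ?E'" using assms(2) by (auto simp: symp_def)
  have V: "?V - {x} = V" using insert by auto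
  have up: "chi ?V F \<le> chi V F + 1" for F
    using chi_Un_card[of V "{x}" F] insert by simp
  have d: "deg ?V E x + deg ?V ?E' x = card V"
    using deg_complement[of ?V x E] insert by simp
  have rem: "chi V F = chi ?V F" if "symp F" "deg ?V F x + 1 < chi ?V F" for F
    using chi_remove_vertex[of ?V x F] insert that V by simp
  show ?case
  proof (cases "deg ?V E x + 1 < chi ?V E \<or> deg ?V ?E' x + 1 < chi ?V ?E'")
    case True
    then show ?thesis
      using rem[of E] rem[of ?E'] assms(2) sym' up[of E] up[of ?E'] insert by auto
  next
    case False
    then show ?thesis using d insert by simp
  qed
qed

text \<open>If deleting both \<open>u\<close> and \<open>v\<close> does not lower the chromatic number, then the bound for the rest
  forces the complement to lose two colours, so \<open>u\<close> and \<open>v\<close> cannot share a colour there.\<close>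

lemma NG_pair_nonadjacent:
  assumes "finite V" "symp E"
    and NG: "chi V E + chi V (\<lambda>u v. \<not> E u v) = card V + 1"
    and uv: "u \<in> V" "v \<in> V" "u \<noteq> v"
    and du: "deg V E u + 1 < chi V E"
    and dv: "deg (V - {u}) E v + 1 < chi V E"
  shows "\<not> E u v"
proof
  assume E: "E u v"
  let ?W = "V - {u} - {v}"
  have "chi (V - {u}) E = chi V E"
    using assms by (intro chi_remove_vertex) auto
  moreover from this have "chi ?W E = chi (V - {u}) E"
    using assms by (intro chi_remove_vertex) auto
  moreover have "chi ?W E + chi ?W (\<lambda>u v. \<not> E u v) \<le> card ?W + 1"
    using assms by (intro nordhaus_gaddum) auto
  moreover have "card ?W + 2 = card V"
    using uv assms(1) card_Suc_Diff1[of V u] card_Suc_Diff1[of "V - {u}" v] by simp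
  moreover have "chi (?W \<union> {u, v}) (\<lambda>u v. \<not> E u v) \<le> chi ?W (\<lambda>u v. \<not> E u v) + 1"
    using assms E by (intro chi_Un_stable) (auto simp: symp_def)
  moreover have "?W \<union> {u, v} = V" using uv by auto
  ultimately show False using NG by simp
qed

text \<open>Were \<open>u\<close> and \<open>v\<close> adjacent, deleting \<open>u\<close> would
  lower the degree of \<open>v\<close> and turn its weak bound into the strict one of
  \<open>NG_pair_nonadjacent\<close>. Hence \<open>v\<close> may come from A as well as from
  C.\<close>

lemma NG_low_degree:
  assumes "finite V" "symp E"
    and NG: "chi V E + chi V (\<lambda>u v. \<not> E u v) = card V + 1"
    and uv: "u \<in> V" "v \<in> V" "u \<noteq> v"
    and du: "deg V E u + 1 < chi V E"
    and dv: "deg V E v + 1 \<le> chi V E"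
  shows "\<not> E u v"
proof
  assume E: "E u v"
  have "{w \<in> V - {u}. w \<noteq> v \<and> E w v} \<subset> {w \<in> V. w \<noteq> v \<and> E w v}"
    using uv E by auto
  then have "deg (V - {u}) E v < deg V E v"
    unfolding deg_def using assms(1) by (intro psubset_card_mono) auto
  then have "\<not> E u v"
    using dv by (intro NG_pair_nonadjacent[OF assms(1-3) uv du]) simp
  with E show False by simp
qed

text \<open>Passing to the complement exchanges the vertices of low and of high degree.\<close>

lemma NG_high_degree:
  assumes "finite V" "symp E"
    and NG: "chi V E + chi V (\<lambda>u v. \<not> E u v) = card V + 1"
    and uv: "u \<in> V" "v \<in> V" "u \<noteq> v"
    and du: "chi V E < deg V E u + 1"
    and dv: "chi V E \<le> deg V E v + 1"
  shows "E u v"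
proof -
  have "\<not> (\<lambda>u v. \<not> E u v) u v"
  proof (rule NG_low_degree[OF assms(1) _ _ uv])
    show "symp (\<lambda>u v. \<not> E u v)" using assms(2) by (auto simp: symp_def)
    show "chi V (\<lambda>u v. \<not> E u v) + chi V (\<lambda>u v. \<not> \<not> E u v) = card V + 1"
      using NG by simp
    show "deg V (\<lambda>u v. \<not> E u v) u + 1 < chi V (\<lambda>u v. \<not> E u v)"
      using deg_complement[OF assms(1) uv(1), of E] NG du by simp
    show "deg V (\<lambda>u v. \<not> E u v) v + 1 \<le> chi V (\<lambda>u v. \<not> E u v)"
      using deg_complement[OF assms(1) uv(2), of E] NG dv by simp
  qed
  then show ?thesis by simp
qed

text \<open>All of \<open>S\<close> can share one colour already used on \<open>P\<close>, whereas
  \<open>K\<close> needs a new colour for each vertex. The complement has the same shape with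
  \<open>K\<close> and \<open>S\<close> exchanged.\<close>

lemma chi_decompose:
  assumes fin: "finite P" "finite K" "finite S" and "P \<noteq> {}" and disj: "P \<inter> K = {}"
    and "symp E"
    and K: "\<And>u v. u \<in> K \<Longrightarrow> v \<in> K \<Longrightarrow> u \<noteq> v \<Longrightarrow> E u v"
    and S: "\<And>u v. u \<in> S \<Longrightarrow> v \<in> S \<Longrightarrow> u \<noteq> v \<Longrightarrow> \<not> E u v"
    and PK: "\<And>u v. u \<in> P \<Longrightarrow> v \<in> K \<Longrightarrow> E u v"
    and PS: "\<And>u v. u \<in> P \<Longrightarrow> v \<in> S \<Longrightarrow> \<not> E u v"
  shows "chi (P \<union> K \<union> S) E = chi P E + card K"
proof (rule antisym)
  obtain p where p: "p \<in> P" using \<open>P \<noteq> {}\<close> by blast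
  obtain c where c: "proper P E c" "card (c ` P) = chi P E"
    using fin(1) by (rule chi_attained)
  let ?d = "\<lambda>v. if v \<in> P then c v else c p"
  have "\<not> E v u" if "u \<in> P" "v \<in> S" for u v
    using that PS \<open>symp E\<close> by (auto simp: symp_def)
  then have "proper (P \<union> S) E ?d"
    using c(1) p S PS by (auto simp: proper_def)
  moreover have "?d ` (P \<union> S) = c ` P" using p by auto
  ultimately have "chi (P \<union> S) E \<le> chi P E"
    using c(2) by (metis chi_le order_refl)
  moreover have "chi ((P \<union> S) \<union> K) E \<le> chi (P \<union> S) E + card K"
    using fin by (intro chi_Un_card) auto
  ultimately show "chi (P \<union> K \<union> S) E \<le> chi P E + card K"
    by (simp add: Un_ac)
next
  have "finite (P \<union> K)" using fin by simp
  then obtain c where c: "proper (P \<union> K) E c" "card (c ` (P \<union> K)) = chi (P \<union> K) E"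
    by (rule chi_attained)
  have "inj_on c K"
    using c(1) K unfolding inj_on_def proper_def by blast
  moreover have "c ` P \<inter> c ` K = {}"
    using c(1) PK disj unfolding proper_def by (auto; metis IntI UnI1 UnI2 empty_iff)
  ultimately have "card (c ` P) + card K = chi (P \<union> K) E"
    using fin c(2) by (metis card_Un_disjoint card_image finite_imageI image_Un)
  moreover have "chi P E \<le> card (c ` P)"
    using c(1) by (intro chi_le[of _ _ c]) (auto intro: proper_mono)
  moreover have "chi (P \<union> K) E \<le> chi (P \<union> K \<union> S) E"
    using fin by (intro chi_mono) auto
  ultimately show "chi P E + card K \<le> chi (P \<union> K \<union> S) E" by simp
qed

lemma chi_clique:
  assumes "finite P" "\<And>u v. u \<in> P \<Longrightarrow> v \<in> P \<Longrightarrow> u \<noteq> v \<Longrightarrow> E u v"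
  shows "chi P E = card P"
proof -
  obtain c where c: "proper P E c" "card (c ` P) = chi P E"
    using assms(1) by (rule chi_attained)
  then have "inj_on c P"
    using assms(2) unfolding inj_on_def proper_def by blast
  with c show ?thesis by (simp add: card_image)
qed

lemma chi_stable:
  assumes "finite P" "P \<noteq> {}" "\<And>u v. u \<in> P \<Longrightarrow> v \<in> P \<Longrightarrow> u \<noteq> v \<Longrightarrow> \<not> E u v"
  shows "chi P E = 1"
proof -
  have "chi P E \<le> 1"
    using assms(2,3) by (intro chi_le[of _ _ "\<lambda>_. 0"]) (auto simp: proper_def image_constant_conv)
  moreover obtain c where "proper P E c" "card (c ` P) = chi P E"
    using assms(1) by (rule chi_attained)
  then have "chi P E \<noteq> 0" using assms by auto
  ultimately show ?thesis by simp
qed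

section \<open>From graphs to adjacency relations, and the structure of NG-graphs\<close>

lemma symp_adjacent: "symp (adjacent G)"
  by (auto simp: symp_def adjacent_def insert_commute)

lemma adjacent_commute: "adjacent G u v \<longleftrightarrow> adjacent G v u"
  by (simp add: adjacent_def insert_commute)

lemma simple_graph_adjacent:
  assumes "simple_graph G" "adjacent G u v"
  shows "u \<noteq> v" "u \<in> verts G" "v \<in> verts G"
  using assms by (auto simp: simple_graph_def adjacent_def)

lemma adjacent_complement:
  assumes "u \<in> verts G" "v \<in> verts G"
  shows "adjacent (graph_complement G) u v \<longleftrightarrow> u \<noteq> v \<and> \<not> adjacent G u v"
  using assms by (auto simp: adjacent_def graph_complement_def card_insert_if)

text \<open>The colours in use can be renumbered injectively by an initial segment of the naturals,
  so a palette of \<open>k\<close> colours and at most \<open>k\<close> used values amount to the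
  same.\<close>

lemma colorable_iff:
  assumes "finite (verts G)" "\<And>v. \<not> adjacent G v v"
  shows "colorable G k \<longleftrightarrow> (\<exists>c. proper (verts G) (adjacent G) c \<and> card (c ` verts G) \<le> k)"
proof
  assume "colorable G k"
  then obtain c :: "'a \<Rightarrow> nat" where "c ` verts G \<subseteq> {..<k}"
    "\<forall>u\<in>verts G. \<forall>v\<in>verts G. adjacent G u v \<longrightarrow> c u \<noteq> c v"
    unfolding colorable_def by blast
  moreover from this(1) have "card (c ` verts G) \<le> k"
    using card_mono[of "{..<k}"] by fastforce
  ultimately show "\<exists>c. proper (verts G) (adjacent G) c \<and> card (c ` verts G) \<le> k"
    unfolding proper_def by blast
next
  assume "\<exists>c. proper (verts G) (adjacent G) c \<and> card (c ` verts G) \<le> k"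
  then obtain c where c: "proper (verts G) (adjacent G) c" "card (c ` verts G) \<le> k" by blast
  have "finite (c ` verts G)" using assms by simp
  then obtain h where h: "bij_betw h (c ` verts G) {0..<card (c ` verts G)}"
    using ex_bij_betw_finite_nat by blast
  have "(h \<circ> c) ` verts G \<subseteq> {..<k}"
    using c(2) bij_betwE[OF h] by fastforce
  moreover have "(h \<circ> c) u \<noteq> (h \<circ> c) v"
    if uv: "u \<in> verts G" "v \<in> verts G" "adjacent G u v" for u v
  proof -
    have "u \<noteq> v" using uv assms by auto
    then have "c u \<noteq> c v" using c(1) uv by (auto simp: proper_def)
    then show ?thesis
      using bij_betw_imp_inj_on[OF h] uv by (auto simp: inj_on_def)
  qed
  ultimately show "colorable G k"
    unfolding colorable_def by blast
qed

lemma chromatic_number_chi: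
  assumes "simple_graph G"
  shows "chromatic_number G = chi (verts G) (adjacent G)"
proof -
  have "colorable G k \<longleftrightarrow> (\<exists>c. proper (verts G) (adjacent G) c \<and> card (c ` verts G) \<le> k)" for k
  proof (rule colorable_iff)
    show "finite (verts G)" using assms by (simp add: simple_graph_def)
    show "\<not> adjacent G v v" for v using simple_graph_adjacent(1)[OF assms] by blast
  qed
  then show ?thesis by (simp add: chromatic_number_def chi_def)
qed

lemma simple_graph_complement: "simple_graph G \<Longrightarrow> simple_graph (graph_complement G)"
  by (auto simp: simple_graph_def graph_complement_def)

lemma verts_complement [simp]: "verts (graph_complement G) = verts G"
  by (simp add: graph_complement_def)

lemma chromatic_number_complement:
  assumes "simple_graph G"
  shows "chromatic_number (graph_complement G) = chi (verts G) (\<lambda>u v. \<not> adjacent G u v)"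
proof -
  have "chromatic_number (graph_complement G)
      = chi (verts G) (adjacent (graph_complement G))"
    using chromatic_number_chi[OF simple_graph_complement[OF assms]] by simp
  also have "\<dots> = chi (verts G) (\<lambda>u v. \<not> adjacent G u v)"
    by (rule chi_cong) (simp add: adjacent_complement)
  finally show ?thesis .
qed

lemma vdegree_deg: "simple_graph G \<Longrightarrow> vdegree G v = deg (verts G) (adjacent G) v"
  unfolding vdegree_def deg_def
  by (intro arg_cong[where f = card]) (auto dest: simple_graph_adjacent(1) simp: adjacent_commute)

lemma NG_graph_iff:
  "simple_graph G \<Longrightarrow> NG_graph G \<longleftrightarrow>
     chi (verts G) (adjacent G) + chi (verts G) (\<lambda>u v. \<not> adjacent G u v) = card (verts G) + 1"
  by (simp add: NG_graph_def chromatic_number_chi chromatic_number_complement)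

definition B_part :: "'a sgraph \<Rightarrow> 'a set" where
  "B_part G = {v \<in> verts G. chromatic_number G < vdegree G v + 1}"

definition C_part :: "'a sgraph \<Rightarrow> 'a set" where
  "C_part G = {v \<in> verts G. vdegree G v + 1 < chromatic_number G}"

lemma ABC_partition:
  "verts G = A_part G \<union> B_part G \<union> C_part G"
  "A_part G \<inter> B_part G = {}" "A_part G \<inter> C_part G = {}" "B_part G \<inter> C_part G = {}"
  by (auto simp: A_part_def B_part_def C_part_def)

theorem NG_graph_structure:
  assumes "simple_graph G" "NG_graph G"
  shows "u \<in> C_part G \<Longrightarrow> v \<in> A_part G \<union> C_part G \<Longrightarrow> \<not> adjacent G u v"
    and "u \<in> B_part G \<Longrightarrow> v \<in> A_part G \<union> B_part G \<Longrightarrow> u \<noteq> v \<Longrightarrow> adjacent G u v"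
proof -
  have fin: "finite (verts G)" using assms(1) by (simp add: simple_graph_def)
  have NG: "chi (verts G) (adjacent G) + chi (verts G) (\<lambda>u v. \<not> adjacent G u v) = card (verts G) + 1"
    using assms by (simp add: NG_graph_iff)
  show "\<not> adjacent G u v" if "u \<in> C_part G" "v \<in> A_part G \<union> C_part G"
    using NG_low_degree[OF fin symp_adjacent NG, of u v] that simple_graph_adjacent(1)[OF assms(1)]
    by (cases "u = v")
      (auto simp: A_part_def C_part_def chromatic_number_chi[OF assms(1)] vdegree_deg[OF assms(1)])
  show "adjacent G u v" if "u \<in> B_part G" "v \<in> A_part G \<union> B_part G" "u \<noteq> v"
    using NG_high_degree[OF fin symp_adjacent NG, of u v] that
    by (auto simp: A_part_def B_part_def chromatic_number_chi[OF assms(1)] vdegree_deg[OF assms(1)])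
qed

section \<open>Isomorphism invariance\<close>

definition graph_iso :: "('a \<Rightarrow> 'b) \<Rightarrow> 'a sgraph \<Rightarrow> 'b sgraph \<Rightarrow> bool" where
  "graph_iso f G H \<longleftrightarrow> bij_betw f (verts G) (verts H) \<and>
     (\<forall>u\<in>verts G. \<forall>v\<in>verts G. adjacent G u v \<longleftrightarrow> adjacent H (f u) (f v))"

lemma isomorphic_iff: "isomorphic G H \<longleftrightarrow> (\<exists>f. graph_iso f G H)"
  by (simp add: isomorphic_def graph_iso_def)

lemma graph_iso_verts: "graph_iso f G H \<Longrightarrow> verts H = f ` verts G"
  by (simp add: graph_iso_def bij_betw_def)

lemma graph_iso_inj: "graph_iso f G H \<Longrightarrow> inj_on f (verts G)"
  by (simp add: graph_iso_def bij_betw_def)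

lemma graph_iso_adjacent:
  "graph_iso f G H \<Longrightarrow> u \<in> verts G \<Longrightarrow> v \<in> verts G \<Longrightarrow> adjacent H (f u) (f v) \<longleftrightarrow> adjacent G u v"
  by (simp add: graph_iso_def)

lemma graph_iso_comp: "graph_iso f G H \<Longrightarrow> graph_iso g H I \<Longrightarrow> graph_iso (g \<circ> f) G I"
  by (auto simp: graph_iso_def bij_betwE intro: bij_betw_trans)

lemma colorable_iso:
  assumes "isomorphic G H" "colorable H k"
  shows "colorable G k"
proof -
  obtain f where f: "graph_iso f G H" using assms(1) by (auto simp: isomorphic_iff)
  obtain c :: "'b \<Rightarrow> nat" where c: "c ` verts H \<subseteq> {..<k}"
    "\<forall>u\<in>verts H. \<forall>v\<in>verts H. adjacent H u v \<longrightarrow> c u \<noteq> c v"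
    using assms(2) unfolding colorable_def by blast
  have "(c \<circ> f) ` verts G \<subseteq> {..<k}"
    using c(1) graph_iso_verts[OF f] by auto
  moreover have "\<forall>u\<in>verts G. \<forall>v\<in>verts G. adjacent G u v \<longrightarrow> (c \<circ> f) u \<noteq> (c \<circ> f) v"
    using c(2) graph_iso_verts[OF f] graph_iso_adjacent[OF f] by auto
  ultimately show ?thesis unfolding colorable_def by blast
qed

lemma chromatic_number_iso: "isomorphic G H \<Longrightarrow> chromatic_number G = chromatic_number H"
  unfolding chromatic_number_def by (metis colorable_iso isomorphic_sym)

lemma complement_iso:
  assumes "isomorphic G H"
  shows "isomorphic (graph_complement G) (graph_complement H)"
proof -
  obtain f where f: "graph_iso f G H" using assms by (auto simp: isomorphic_iff)
  have "adjacent (graph_complement G) u v \<longleftrightarrow> adjacent (graph_complement H) (f u) (f v)"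
    if "u \<in> verts G" "v \<in> verts G" for u v
    using that graph_iso_adjacent[OF f] graph_iso_verts[OF f] graph_iso_inj[OF f]
    by (simp add: adjacent_complement inj_on_eq_iff)
  then have "graph_iso f (graph_complement G) (graph_complement H)"
    using f by (simp add: graph_iso_def)
  then show ?thesis by (auto simp: isomorphic_iff)
qed

lemma card_verts_iso: "isomorphic G H \<Longrightarrow> card (verts G) = card (verts H)"
  by (auto simp: isomorphic_def bij_betw_same_card)

lemma vdegree_iso:
  assumes "graph_iso f G H" "v \<in> verts G"
  shows "vdegree H (f v) = vdegree G v"
proof -
  have "{u \<in> verts H. adjacent H u (f v)} = f ` {u \<in> verts G. adjacent G u v}"
    using assms by (auto simp: graph_iso_verts graph_iso_adjacent)
  moreover have "inj_on f {u \<in> verts G. adjacent G u v}"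
    using graph_iso_inj[OF assms(1)] by (rule inj_on_subset) auto
  ultimately show ?thesis
    by (simp add: vdegree_def card_image)
qed

lemma graph_iso_chromatic: "graph_iso f G H \<Longrightarrow> chromatic_number H = chromatic_number G"
  using chromatic_number_iso isomorphic_iff by metis

lemma A_part_iso: "graph_iso f G H \<Longrightarrow> A_part H = f ` A_part G"
  by (auto simp: A_part_def graph_iso_verts vdegree_iso graph_iso_chromatic)

lemma C_part_iso: "graph_iso f G H \<Longrightarrow> C_part H = f ` C_part G"
  by (auto simp: C_part_def graph_iso_verts vdegree_iso graph_iso_chromatic)

lemma verts_induced [simp]: "verts (induced G X) = X"
  by (simp add: induced_def)

lemma adjacent_induced [simp]: "adjacent (induced G X) u v \<longleftrightarrow> adjacent G u v \<and> u \<in> X \<and> v \<in> X"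
  by (auto simp: induced_def adjacent_def)

lemma simple_graph_induced: "simple_graph G \<Longrightarrow> X \<subseteq> verts G \<Longrightarrow> simple_graph (induced G X)"
  by (auto simp: simple_graph_def induced_def intro: finite_subset)

lemma induced_iso:
  assumes "graph_iso f G H" "X \<subseteq> verts G"
  shows "graph_iso f (induced G X) (induced H (f ` X))"
proof -
  have "inj_on f X"
    using graph_iso_inj[OF assms(1)] assms(2) by (rule inj_on_subset)
  moreover have "adjacent H (f u) (f v) \<longleftrightarrow> adjacent G u v" if "u \<in> X" "v \<in> X" for u v
    using that assms by (intro graph_iso_adjacent) auto
  ultimately show ?thesis
    by (auto simp: graph_iso_def bij_betw_def)
qed

lemma edgeless_graph_iso: "isomorphic G H \<Longrightarrow> edgeless_graph H \<Longrightarrow> edgeless_graph G"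
  unfolding isomorphic_iff edgeless_graph_def
  by (auto simp: graph_iso_verts graph_iso_adjacent)

section \<open>The 5-cycle: degrees, chromatic number, self-complementarity\<close>

lemma cycle5_adjacent:
  assumes "u < 5" "v < 5"
  shows "adjacent (cycle_graph 5) u v \<longleftrightarrow> v = Suc u mod 5 \<or> u = Suc v mod 5"
  using assms by (auto simp: adjacent_def cycle_graph_def doubleton_eq_iff)

lemma verts_cycle5: "verts (cycle_graph 5) = {0, 1, 2, 3, 4}"
  by (auto simp: cycle_graph_def)

lemma simple_cycle5: "simple_graph (cycle_graph 5)"
proof -
  have "card {i, Suc i mod 5} = 2" if "i < 5" for i :: nat
  proof -
    have "i \<noteq> Suc i mod 5" using that by presburger
    then show ?thesis by simp
  qed
  then show ?thesis by (auto simp: simple_graph_def cycle_graph_def)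
qed

lemma vdegree_cycle5:
  assumes "v < 5"
  shows "vdegree (cycle_graph 5) v = 2"
proof -
  have "{u \<in> verts (cycle_graph 5). adjacent (cycle_graph 5) u v}
      = {u \<in> {0, 1, 2, 3, 4}. v = Suc u mod 5 \<or> u = Suc v mod 5}"
    unfolding verts_cycle5 using assms by (intro Collect_cong conj_cong refl cycle5_adjacent) auto
  also have "\<dots> = {Suc v mod 5, (v + 4) mod 5}"
  proof -
    have "v \<in> {0, 1, 2, 3, 4}" using assms by auto
    then show ?thesis by auto
  qed
  also have "card \<dots> = 2"
  proof -
    have "Suc v mod 5 \<noteq> (v + 4) mod 5" using assms by presburger
    then show ?thesis by simp
  qed
  finally show ?thesis by (simp add: vdegree_def)
qed

lemma colorable_cycle5: "colorable (cycle_graph 5) k \<longleftrightarrow> 3 \<le> k"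
proof
  assume "3 \<le> k"
  \<comment> \<open>The colours around the cycle are 0, 1, 0, 1, 2.\<close>
  have "(\<lambda>i. if i = 4 then 2 else i mod 2) ` verts (cycle_graph 5) \<subseteq> {..<k}"
    using \<open>3 \<le> k\<close> by (auto simp: verts_cycle5)
  moreover have "\<forall>u\<in>{0,1,2,3,4}. \<forall>v\<in>{0,1,2,3,4}. adjacent (cycle_graph 5) u v \<longrightarrow>
      (if u = 4 then 2 else u mod 2) \<noteq> (if v = 4 then 2 else v mod (2::nat))"
    by (simp add: cycle5_adjacent)
  ultimately show "colorable (cycle_graph 5) k"
    unfolding colorable_def verts_cycle5 by (intro exI[of _ "\<lambda>i. if i = 4 then 2 else i mod 2"]) simp
next
  assume "colorable (cycle_graph 5) k"
  then obtain c :: "nat \<Rightarrow> nat" where c: "\<And>u. u < 5 \<Longrightarrow> c u < k"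
    "\<And>u v. u < 5 \<Longrightarrow> v < 5 \<Longrightarrow> adjacent (cycle_graph 5) u v \<Longrightarrow> c u \<noteq> c v"
    unfolding colorable_def cycle_graph_def by auto
  have "c 0 \<noteq> c 1" "c 1 \<noteq> c 2" "c 2 \<noteq> c 3" "c 3 \<noteq> c 4" "c 4 \<noteq> c 0"
    by (rule c(2); simp add: cycle5_adjacent)+
  moreover have "c 0 < k" "c 1 < k" "c 2 < k" "c 3 < k" "c 4 < k"
    by (rule c(1); simp)+
  \<comment> \<open>With two colours the disequalities would force alternation around an odd cycle;
    splitting each of them leaves linear cases.\<close>
  ultimately show "3 \<le> k" by linarith
qed

lemma chromatic_number_cycle5: "chromatic_number (cycle_graph 5) = 3"
  unfolding chromatic_number_def colorable_cycle5 by (rule Least_equality) auto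

lemma cycle5_self_complementary: "isomorphic (cycle_graph 5) (graph_complement (cycle_graph 5))"
proof -
  \<comment> \<open>Doubling modulo 5 turns the differences 1 and 4 into 2 and 3, so edges become
    non-edges.\<close>
  let ?f = "\<lambda>i::nat. 2 * i mod 5"
  have bij: "bij_betw ?f (verts (cycle_graph 5)) (verts (cycle_graph 5))"
    unfolding verts_cycle5 bij_betw_def by (auto simp: inj_on_def)
  have adj: "\<forall>u\<in>verts (cycle_graph 5). \<forall>v\<in>verts (cycle_graph 5).
      adjacent (cycle_graph 5) u v \<longleftrightarrow> ?f u \<noteq> ?f v \<and> \<not> adjacent (cycle_graph 5) (?f u) (?f v)"
    unfolding verts_cycle5 by (simp add: cycle5_adjacent)
  have "graph_iso ?f (cycle_graph 5) (graph_complement (cycle_graph 5))"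
    unfolding graph_iso_def verts_complement
  proof (intro conjI bij ballI)
    fix u v assume uv: "u \<in> verts (cycle_graph 5)" "v \<in> verts (cycle_graph 5)"
    note f = uv[THEN bij_betwE[OF bij, rule_format]]
    show "adjacent (cycle_graph 5) u v \<longleftrightarrow> adjacent (graph_complement (cycle_graph 5)) (?f u) (?f v)"
      unfolding adjacent_complement[OF f] using adj uv by blast
  qed
  then show ?thesis unfolding isomorphic_iff by blast
qed

section \<open>Passing from labelled graphs to isomorphism classes\<close>

text \<open>One direction of \<open>iff\<close> makes \<open>F\<close> well defined on classes, the
  other makes the induced map injective. Surjectivity is needed only up to \<open>r\<close>, so no
  inverse of \<open>F\<close> has to be constructed.\<close>

lemma quotient_bij:
  assumes r: "equiv U r" and X: "X \<subseteq> U" and Y: "Y \<subseteq> U" and F: "F ` X \<subseteq> Y"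
    and iff: "\<And>x y. x \<in> X \<Longrightarrow> y \<in> X \<Longrightarrow> (F x, F y) \<in> r \<longleftrightarrow> (x, y) \<in> r"
    and surj: "\<And>y. y \<in> Y \<Longrightarrow> \<exists>x\<in>X. (F x, y) \<in> r"
  shows "\<exists>f. bij_betw f (X // r) (Y // r)"
proof -
  define f where "f c = r `` {F (SOME x. x \<in> X \<and> c = r `` {x})}" for c
  have f: "f (r `` {x}) = r `` {F x}" if x: "x \<in> X" for x
  proof -
    let ?y = "SOME y. y \<in> X \<and> r `` {x} = r `` {y}"
    have y: "?y \<in> X \<and> r `` {x} = r `` {?y}"
      by (rule someI[of _ x]) (simp add: x)
    then have "(x, ?y) \<in> r"
      using x X eq_equiv_class_iff[OF r, of x ?y] by blast
    then have "(F x, F ?y) \<in> r" using iff x y by blast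
    then show ?thesis using equiv_class_eq[OF r] by (simp add: f_def)
  qed
  have "inj_on f (X // r)"
  proof (rule inj_onI)
    fix c d assume "c \<in> X // r" "d \<in> X // r" and eq: "f c = f d"
    then obtain x y where xy: "x \<in> X" "c = r `` {x}" "y \<in> X" "d = r `` {y}"
      by (auto elim!: quotientE)
    then have "r `` {F x} = r `` {F y}" using eq f by simp
    moreover have "F x \<in> U" "F y \<in> U" using F Y xy by auto
    ultimately have "(F x, F y) \<in> r" using eq_equiv_class_iff[OF r] by blast
    then have "(x, y) \<in> r" using iff xy by blast
    then show "c = d" using equiv_class_eq[OF r] xy by simp
  qed
  moreover have "f ` (X // r) = Y // r"
  proof
    show "f ` (X // r) \<subseteq> Y // r"
      using F f by (auto elim!: quotientE intro!: quotientI)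
    show "Y // r \<subseteq> f ` (X // r)"
    proof
      fix d assume "d \<in> Y // r"
      then obtain y where y: "y \<in> Y" "d = r `` {y}" by (rule quotientE)
      then obtain x where x: "x \<in> X" "(F x, y) \<in> r" using surj by blast
      then have "d = f (r `` {x})"
        using f y(2) equiv_class_eq[OF r] by simp
      then show "d \<in> f ` (X // r)" using x(1) by (auto intro: quotientI)
    qed
  qed
  ultimately show ?thesis unfolding bij_betw_def by blast
qed

lemma iso_class_eq_iff:
  "simple_graph G \<Longrightarrow> simple_graph H \<Longrightarrow> iso_rel `` {G} = iso_rel `` {H} \<longleftrightarrow> isomorphic G H"
  by (simp add: eq_equiv_class_iff[OF equiv_iso_rel]) (simp add: iso_rel_def)

text \<open>The order is constant on a class. Simplicity puts \<open>G\<close> into its own class,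
  which guards against an empty class satisfying the order condition vacuously.\<close>

lemma of_order_quotient:
  assumes "\<And>G. P G \<Longrightarrow> simple_graph G"
  shows "of_order ({G. P G} // iso_rel) k = {G. P G \<and> card (verts G) = k} // iso_rel"
proof -
  have card: "(\<forall>H\<in>iso_rel `` {G}. card (verts H) = k) \<longleftrightarrow> card (verts G) = k" if "P G" for G
  proof -
    have "G \<in> iso_rel `` {G}"
      using assms[OF that] isomorphic_refl by (simp add: iso_rel_def)
    moreover have "card (verts H) = card (verts G)" if "H \<in> iso_rel `` {G}" for H
      using that iso_rel_card[of G H] by (simp only: Image_singleton_iff)
    ultimately show ?thesis by metis
  qed
  show ?thesis
  proof (rule set_eqI)
    fix c
    have "c \<in> of_order ({G. P G} // iso_rel) k \<longleftrightarrow>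
        (\<exists>G. P G \<and> c = iso_rel `` {G} \<and> (\<forall>H\<in>iso_rel `` {G}. card (verts H) = k))"
      unfolding of_order_def quotient_def by blast
    also have "\<dots> \<longleftrightarrow> (\<exists>G. P G \<and> c = iso_rel `` {G} \<and> card (verts G) = k)"
      using card by metis
    also have "\<dots> \<longleftrightarrow> c \<in> {G. P G \<and> card (verts G) = k} // iso_rel"
      unfolding quotient_def by blast
    finally show "c \<in> of_order ({G. P G} // iso_rel) k \<longleftrightarrow> c \<in> {G. P G \<and> card (verts G) = k} // iso_rel" .
  qed
qed

lemma Split_upto_eq:
  "Split_upto (int n - int q)
     = {H. simple_graph H \<and> split_graph H \<and> card (verts H) + q \<le> n} // iso_rel"
proof -
  have "of_order Split i = {H. (simple_graph H \<and> split_graph H) \<and> card (verts H) = i} // iso_rel" for i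
    unfolding Split_def unlabeled_def by (rule of_order_quotient) simp
  then have "Split_upto (int n - int q) = (\<Union>i\<in>{i. int i \<le> int n - int q}.
      {H. (simple_graph H \<and> split_graph H) \<and> card (verts H) = i} // iso_rel)"
    by (simp add: Split_upto_def)
  also have "\<dots> = (\<Union>i\<in>{i. int i \<le> int n - int q}.
      {H. (simple_graph H \<and> split_graph H) \<and> card (verts H) = i}) // iso_rel"
    unfolding quotient_def by blast
  also have "(\<Union>i\<in>{i. int i \<le> int n - int q}.
      {H. (simple_graph H \<and> split_graph H) \<and> card (verts H) = i})
     = {H. simple_graph H \<and> split_graph H \<and> card (verts H) + q \<le> n}"
    by auto
  finally show ?thesis .
qed

section \<open>Blow-ups and split partitions\<close>

text \<open>\<open>P\<close>, \<open>K\<close>, \<open>S\<close> are to become A, B, C. The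
  chromatic numbers of the graph and its complement grow by \<open>card K\<close> and
  \<open>card S\<close>, and degrees in \<open>P\<close> grow by \<open>card K\<close>. A vertex of
  \<open>K\<close> sees all of \<open>P\<close> and the rest of \<open>K\<close>; this exceeds the
  threshold if \<open>P\<close> needs fewer colours than it has vertices, or else with the help of a
  neighbour in \<open>S\<close>. A vertex of \<open>S\<close> has at most \<open>card K\<close>
  neighbours, which is low enough by \<open>ge2\<close>.\<close>

lemma NG_blowup:
  assumes G: "simple_graph G" and V: "verts G = P \<union> K \<union> S"
    and disj: "P \<inter> K = {}" "P \<inter> S = {}" "K \<inter> S = {}" and "P \<noteq> {}"
    and K: "\<And>u v. u \<in> K \<Longrightarrow> v \<in> K \<Longrightarrow> u \<noteq> v \<Longrightarrow> adjacent G u v"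
    and S: "\<And>u v. u \<in> S \<Longrightarrow> v \<in> S \<Longrightarrow> \<not> adjacent G u v"
    and PK: "\<And>u v. u \<in> P \<Longrightarrow> v \<in> K \<Longrightarrow> adjacent G u v"
    and PS: "\<And>u v. u \<in> P \<Longrightarrow> v \<in> S \<Longrightarrow> \<not> adjacent G u v"
    and NG: "chi P (adjacent G) + chi P (\<lambda>u v. \<not> adjacent G u v) = card P + 1"
    and regular: "\<And>v. v \<in> P \<Longrightarrow> deg P (adjacent G) v + 1 = chi P (adjacent G)"
    and ge2: "2 \<le> chi P (adjacent G)"
    and up: "\<And>v. v \<in> K \<Longrightarrow> chi P (adjacent G) < card P \<or> (\<exists>s\<in>S. adjacent G v s)"
  shows "NG_graph G" "A_part G = P" "C_part G = S"
proof -
  let ?E = "adjacent G" and ?V = "verts G"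
  have "finite ?V" using G by (simp add: simple_graph_def)
  then have fin: "finite P" "finite K" "finite S" using V by auto
  have chiG: "chi ?V ?E = chi P ?E + card K"
    unfolding V using fin \<open>P \<noteq> {}\<close> disj(1) symp_adjacent K S PK PS by (rule chi_decompose)
  \<comment> \<open>In the complement \<open>S\<close> is the clique joined to \<open>P\<close>, and
    \<open>K\<close> the stable set that sees nothing of \<open>P\<close>.\<close>
  have "chi (P \<union> S \<union> K) (\<lambda>u v. \<not> ?E u v) = chi P (\<lambda>u v. \<not> ?E u v) + card S"
    using symp_adjacent[of G] fin \<open>P \<noteq> {}\<close> disj K S PK PS
    by (intro chi_decompose) (auto simp: symp_def)
  moreover have "P \<union> S \<union> K = ?V" using V by auto
  moreover have "card ?V = card P + card K + card S"
    unfolding V using fin disj by (simp add: card_Un_disjoint Int_Un_distrib2)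
  ultimately show "NG_graph G"
    using chiG NG by (simp add: NG_graph_iff[OF G])
  have chiP: "chi P ?E \<le> card P"
    using chi_Un_card[of "{}" P ?E] fin by (simp add: chi_empty)
  have degP: "deg ?V ?E v + 1 = chi ?V ?E" if v: "v \<in> P" for v
  proof -
    have "\<not> ?E u v" if "u \<in> S" for u
      using PS[OF v that] by (simp add: adjacent_commute)
    moreover have "?E u v \<and> u \<noteq> v" if "u \<in> K" for u
      using PK[OF v that] simple_graph_adjacent(1)[OF G PK[OF v that]] by (simp add: adjacent_commute)
    ultimately have "{u \<in> ?V. u \<noteq> v \<and> ?E u v} = {u \<in> P. u \<noteq> v \<and> ?E u v} \<union> K"
      unfolding V by blast
    moreover have "card ({u \<in> P. u \<noteq> v \<and> ?E u v} \<union> K) = deg P ?E v + card K"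
      unfolding deg_def using fin disj by (intro card_Un_disjoint) auto
    ultimately show ?thesis using regular[OF v] chiG by (simp add: deg_def[of ?V])
  qed
  have degK: "chi ?V ?E < deg ?V ?E v + 1" if v: "v \<in> K" for v
  proof -
    let ?N = "{u \<in> ?V. u \<noteq> v \<and> ?E u v}"
    have finN: "finite ?N" using \<open>finite ?V\<close> by simp
    have sub: "P \<union> K - {v} \<subseteq> ?N"
      using K PK v by (auto simp: V)
    have cPK: "card (P \<union> K) = card P + card K" using fin disj by (simp add: card_Un_disjoint)
    then have c: "card (P \<union> K - {v}) + 1 = card P + card K"
      using card_Suc_Diff1[of "P \<union> K" v] fin v by simp
    from up[OF v] show ?thesis
    proof
      assume "chi P ?E < card P"
      moreover have "card (P \<union> K - {v}) \<le> card ?N" using finN sub by (rule card_mono)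
      ultimately show ?thesis using c chiG by (simp add: deg_def)
    next
      assume "\<exists>s\<in>S. ?E v s"
      then obtain s where s: "s \<in> S" "?E v s" by blast
      have "s \<in> ?N" using s simple_graph_adjacent[OF G s(2)] by (simp add: adjacent_commute)
      then have "card (insert s (P \<union> K - {v})) \<le> card ?N"
        using finN sub by (intro card_mono) auto
      moreover have "s \<notin> P \<union> K - {v}" using s disj by auto
      ultimately have "card (P \<union> K - {v}) + 1 \<le> card ?N" using fin by simp
      then show ?thesis using c chiG chiP by (simp add: deg_def)
    qed
  qed
  have degS: "deg ?V ?E v + 1 < chi ?V ?E" if v: "v \<in> S" for v
  proof -
    have "{u \<in> ?V. u \<noteq> v \<and> ?E u v} \<subseteq> K"
      unfolding V using PS S v by blast
    then have "deg ?V ?E v \<le> card K"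
      unfolding deg_def using fin by (intro card_mono)
    then show ?thesis using ge2 chiG by simp
  qed
  show "A_part G = P"
    unfolding A_part_def chromatic_number_chi[OF G] vdegree_deg[OF G]
    using degP degK degS V by (auto; fastforce)
  show "C_part G = S"
    unfolding C_part_def chromatic_number_chi[OF G] vdegree_deg[OF G]
    using degP degK degS V by (auto; fastforce)
qed

section \<open>Normalised split partitions and their uniqueness\<close>

text \<open>The last conjunct says that no vertex can be moved from \<open>K\<close> to \<open>S\<close>.\<close>

definition smax_partition :: "('a \<Rightarrow> 'a \<Rightarrow> bool) \<Rightarrow> 'a set \<Rightarrow> 'a set \<Rightarrow> bool" where
  "smax_partition E K S \<longleftrightarrow> K \<inter> S = {} \<and> (\<forall>u\<in>K. \<forall>v\<in>K. u \<noteq> v \<longrightarrow> E u v) \<and>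
     (\<forall>u\<in>S. \<forall>v\<in>S. \<not> E u v) \<and> (\<forall>u\<in>K. \<exists>s\<in>S. E u s)"

text \<open>One move suffices: once a vertex \<open>k\<close> without neighbours in \<open>S\<close>
  has been moved there, every other vertex of \<open>K\<close> has \<open>k\<close> itself as a
  neighbour on the stable side.\<close>

lemma smax_partition_exists:
  assumes "simple_graph H" "split_graph H"
  obtains K S where "verts H = K \<union> S" "smax_partition (adjacent H) K S"
proof -
  obtain K S where KS: "K \<union> S = verts H" "K \<inter> S = {}"
    "\<And>u v. u \<in> K \<Longrightarrow> v \<in> K \<Longrightarrow> u \<noteq> v \<Longrightarrow> adjacent H u v"
    "\<And>u v. u \<in> S \<Longrightarrow> v \<in> S \<Longrightarrow> \<not> adjacent H u v"
    using assms(2) by (auto simp: split_graph_def complete_graph_def edgeless_graph_def)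
  show ?thesis
  proof (cases "\<forall>u\<in>K. \<exists>s\<in>S. adjacent H u s")
    case True
    have "smax_partition (adjacent H) K S"
      unfolding smax_partition_def using KS(2-4) True by simp
    with that KS(1) show ?thesis by metis
  next
    case False
    then obtain k where k: "k \<in> K" "\<And>s. s \<in> S \<Longrightarrow> \<not> adjacent H k s" by blast
    have "smax_partition (adjacent H) (K - {k}) (insert k S)"
      unfolding smax_partition_def
    proof (intro conjI ballI impI)
      show "(K - {k}) \<inter> insert k S = {}" using KS(2) by auto
      show "adjacent H u v" if "u \<in> K - {k}" "v \<in> K - {k}" "u \<noteq> v" for u v
        using that KS(3) by blast
      show "\<not> adjacent H u v" if "u \<in> insert k S" "v \<in> insert k S" for u v
        using that KS(4) k(2) simple_graph_adjacent(1)[OF assms(1)] adjacent_commute[of H]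
        by (metis insertE)
      show "\<exists>s\<in>insert k S. adjacent H u s" if "u \<in> K - {k}" for u
        using that KS(3) k(1) by blast
    qed
    moreover have "verts H = (K - {k}) \<union> insert k S" using KS(1) k(1) by auto
    ultimately show ?thesis using that by blast
  qed
qed

text \<open>Since \<open>S'\<close> lies within \<open>S\<close>, a vertex of \<open>K'\<close> in
  \<open>S\<close> would find its required neighbour in \<open>S'\<close> inside the stable set
  \<open>S\<close>.\<close>

lemma smax_partition_eq:
  assumes "K \<union> S = K' \<union> S'" "smax_partition E K S" "smax_partition E K' S'" "K \<inter> S' = {}"
  shows "K = K' \<and> S = S'"
proof -
  have "S' \<subseteq> S" "K \<subseteq> K'" using assms(1,4) by auto
  moreover have "K' \<inter> S = {}"
  proof (rule ccontr)
    assume "K' \<inter> S \<noteq> {}"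
    then obtain y where "y \<in> K'" "y \<in> S" by blast
    moreover from this obtain s where "s \<in> S'" "E y s"
      using assms(3) by (auto simp: smax_partition_def)
    ultimately show False
      using assms(2) \<open>S' \<subseteq> S\<close> by (auto simp: smax_partition_def)
  qed
  ultimately show ?thesis using assms by (auto simp: smax_partition_def)
qed

text \<open>Two such partitions that differ are related by the exchange of a pair of adjacent twins.\<close>

lemma smax_partition_unique:
  assumes V: "verts L = K \<union> S" "verts L = K' \<union> S'"
    and KS: "smax_partition (adjacent L) K S" and KS': "smax_partition (adjacent L) K' S'"
  obtains t where "graph_iso t L L" "t ` K = K'" "t ` S = S'"
proof (cases "K \<inter> S' = {} \<or> K' \<inter> S = {}")
  case True
  moreover have eq: "K \<union> S = K' \<union> S'" using V by simp
  ultimately have "K = K' \<and> S = S'"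
    using smax_partition_eq[OF eq KS KS'] smax_partition_eq[OF eq[symmetric] KS' KS] by metis
  then show ?thesis using that[of id] by (simp add: graph_iso_def)
next
  case False
  then obtain x y where x: "x \<in> K" "x \<in> S'" and y: "y \<in> K'" "y \<in> S" by blast
  have K: "adjacent L u v" if "u \<in> K" "v \<in> K" "u \<noteq> v" for u v
    using KS that by (auto simp: smax_partition_def)
  have S: "\<not> adjacent L u v" if "u \<in> S" "v \<in> S" for u v
    using KS that by (auto simp: smax_partition_def)
  have K': "adjacent L u v" if "u \<in> K'" "v \<in> K'" "u \<noteq> v" for u v
    using KS' that by (auto simp: smax_partition_def)
  have S': "\<not> adjacent L u v" if "u \<in> S'" "v \<in> S'" for u v
    using KS' that by (auto simp: smax_partition_def)
  have disj: "K \<inter> S = {}" "K' \<inter> S' = {}"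
    using KS KS' by (auto simp: smax_partition_def)
  \<comment> \<open>A clique meets a stable set in at most one vertex, so \<open>x\<close> and
    \<open>y\<close> are the only vertices that change sides and \<open>t\<close> need only swap
    them.\<close>
  have uniq: "u = x" if "u \<in> K" "u \<in> S'" for u using that x K S' by blast
  have uniq': "u = y" if "u \<in> K'" "u \<in> S" for u using that y K' S by blast
  define t where "t v = (if v = x then y else if v = y then x else v)" for v
  have tt: "t (t v) = v" for v by (simp add: t_def)
  have K_sub: "t ` K \<subseteq> K'"
  proof
    fix w assume "w \<in> t ` K"
    then obtain v where v: "v \<in> K" "w = t v" by blast
    show "w \<in> K'"
    proof (cases "v = x")
      case False
      then have "v \<noteq> y" "v \<in> K'" using v y disj V uniq by auto
      then show ?thesis using False v by (simp add: t_def)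
    qed (use v y in \<open>simp add: t_def\<close>)
  qed
  have K_sub': "t ` K' \<subseteq> K"
  proof
    fix w assume "w \<in> t ` K'"
    then obtain v where v: "v \<in> K'" "w = t v" by blast
    show "w \<in> K"
    proof (cases "v = y")
      case False
      then have "v \<noteq> x" "v \<in> K" using v x disj V uniq' by auto
      then show ?thesis using False v by (simp add: t_def)
    qed (use v x in \<open>auto simp: t_def\<close>)
  qed
  have S_sub: "t ` S \<subseteq> S'"
  proof
    fix w assume "w \<in> t ` S"
    then obtain v where v: "v \<in> S" "w = t v" by blast
    show "w \<in> S'"
    proof (cases "v = y")
      case False
      then have "v \<noteq> x" "v \<in> S'" using v x disj V uniq' by auto
      then show ?thesis using False v by (simp add: t_def)
    qed (use v x in \<open>auto simp: t_def\<close>)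
  qed
  have S_sub': "t ` S' \<subseteq> S"
  proof
    fix w assume "w \<in> t ` S'"
    then obtain v where v: "v \<in> S'" "w = t v" by blast
    show "w \<in> S"
    proof (cases "v = x")
      case False
      then have "v \<noteq> y" "v \<in> S" using v y disj V uniq by auto
      then show ?thesis using False v by (simp add: t_def)
    qed (use v y in \<open>simp add: t_def\<close>)
  qed
  have tK: "t ` K = K'"
  proof
    have "K' = t ` t ` K'" by (simp add: image_image tt)
    then show "K' \<subseteq> t ` K" using image_mono[OF K_sub', of t] by simp
  qed (rule K_sub)
  have tS: "t ` S = S'"
  proof
    have "S' = t ` t ` S'" by (simp add: image_image tt)
    then show "S' \<subseteq> t ` S" using image_mono[OF S_sub', of t] by simp
  qed (rule S_sub)
  \<comment> \<open>Any other vertex is on the same side in both partitions: on the clique side it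
    is adjacent to \<open>x\<close> through \<open>K\<close> and to \<open>y\<close> through
    \<open>K'\<close>, on the stable side to neither.\<close>
  have twins: "adjacent L x w \<longleftrightarrow> adjacent L y w" if "w \<in> verts L" "w \<noteq> x" "w \<noteq> y" for w
  proof (cases "w \<in> K")
    case True
    then have "w \<in> K'" using uniq that V by auto
    then show ?thesis using True K K' x y that by blast
  next
    case False
    then have "w \<in> S" using that V by auto
    moreover from this have "w \<in> S'" using uniq' that V by auto
    ultimately show ?thesis using S S' x y by blast
  qed
  then have twins': "adjacent L w x \<longleftrightarrow> adjacent L w y" if "w \<in> verts L" "w \<noteq> x" "w \<noteq> y" for w
    using that by (simp add: adjacent_commute[of L w])
  have loop: "\<not> adjacent L x x" "\<not> adjacent L y y" using S S' x y by blast+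
  have "adjacent L u v \<longleftrightarrow> adjacent L (t u) (t v)" if "u \<in> verts L" "v \<in> verts L" for u v
  proof -
    have t: "t x = y" "t y = x" "\<And>w. w \<noteq> x \<Longrightarrow> w \<noteq> y \<Longrightarrow> t w = w" by (simp_all add: t_def)
    consider "u \<noteq> x" "u \<noteq> y" "v \<noteq> x" "v \<noteq> y" | "u \<noteq> x" "u \<noteq> y" "v = x" | "u \<noteq> x" "u \<noteq> y" "v = y"
      | "u = x" "v \<noteq> x" "v \<noteq> y" | "u = y" "v \<noteq> x" "v \<noteq> y"
      | "u = x" "v = x" | "u = x" "v = y" | "u = y" "v = x" | "u = y" "v = y" by blast
    then show ?thesis
      by cases (simp_all add: t twins[OF that(2)] twins'[OF that(1)] loop adjacent_commute[of L y x])
  qed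
  moreover have "t ` verts L = verts L"
  proof -
    have "t ` verts L = t ` K \<union> t ` S" unfolding V(1) by (rule image_Un)
    also have "\<dots> = K' \<union> S'" unfolding tK tS ..
    also have "\<dots> = verts L" by (rule V(2)[symmetric])
    finally show ?thesis .
  qed
  moreover have "inj_on t (verts L)"
    by (rule inj_on_inverseI[of _ t]) (rule tt)
  ultimately have "graph_iso t L L" by (simp add: graph_iso_def bij_betw_def)
  with tK tS that show ?thesis by blast
qed

lemma smax_partition_image:
  assumes "graph_iso h L M" "verts L = K \<union> S" "smax_partition (adjacent L) K S"
  shows "smax_partition (adjacent M) (h ` K) (h ` S)"
proof -
  have "adjacent M (h u) (h v) \<longleftrightarrow> adjacent L u v" if "u \<in> K \<union> S" "v \<in> K \<union> S" for u v
    using graph_iso_adjacent[OF assms(1)] that assms(2) by simp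
  moreover have "h ` K \<inter> h ` S = {}"
    using graph_iso_inj[OF assms(1)] assms(2,3)
    by (auto simp: smax_partition_def inj_on_def)
  ultimately show ?thesis
    using assms(3) unfolding smax_partition_def by (auto 0 4)
qed

section \<open>Decompositions into core, free vertices and split part\<close>

text \<open>\<open>Q\<close> is the prescribed core (\<open>K\<^sub>2\<close> or \<open>C\<^sub>5\<close>), and \<open>Z\<close> collects the remaining vertices without neighbours
  in \<open>S\<close>; all of them are equivalent, so \<open>Q\<close>, the size of \<open>Z\<close> and \<open>G[K \<union> S]\<close> determine \<open>G\<close>.
  For the core \<open>K\<^sub>2\<close> the ABC-partition is \<open>(P \<union> Z, K, S)\<close>; for \<open>C\<^sub>5\<close> it is \<open>(P, Z \<union> K, S)\<close>.\<close>

definition decomposition ::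
  "'b sgraph \<Rightarrow> 'a sgraph \<Rightarrow> 'a set \<Rightarrow> 'a set \<Rightarrow> 'a set \<Rightarrow> 'a set \<Rightarrow> bool" where
  "decomposition Q G P Z K S \<longleftrightarrow> simple_graph G \<and> verts G = P \<union> Z \<union> (K \<union> S) \<and>
     P \<inter> Z = {} \<and> (P \<union> Z) \<inter> (K \<union> S) = {} \<and>
     isomorphic (induced G P) Q \<and> smax_partition (adjacent G) K S \<and>
     (\<forall>u\<in>verts G. \<forall>v\<in>verts G. \<not> (u \<in> P \<and> v \<in> P) \<longrightarrow> \<not> (u \<in> K \<union> S \<and> v \<in> K \<union> S) \<longrightarrow>
        (adjacent G u v \<longleftrightarrow> u \<noteq> v \<and> u \<notin> S \<and> v \<notin> S))"

lemma decompositionD: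
  assumes "decomposition Q G P Z K S"
  shows "simple_graph G" "verts G = P \<union> Z \<union> (K \<union> S)" "P \<inter> Z = {}" "(P \<union> Z) \<inter> (K \<union> S) = {}"
    "isomorphic (induced G P) Q" "smax_partition (adjacent G) K S"
    "\<And>u v. u \<in> verts G \<Longrightarrow> v \<in> verts G \<Longrightarrow> \<not> (u \<in> P \<and> v \<in> P) \<Longrightarrow>
       \<not> (u \<in> K \<union> S \<and> v \<in> K \<union> S) \<Longrightarrow> adjacent G u v \<longleftrightarrow> u \<noteq> v \<and> u \<notin> S \<and> v \<notin> S"
proof -
  show "simple_graph G" "verts G = P \<union> Z \<union> (K \<union> S)" "P \<inter> Z = {}" "(P \<union> Z) \<inter> (K \<union> S) = {}"
    "isomorphic (induced G P) Q" "smax_partition (adjacent G) K S"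
    using assms unfolding decomposition_def by - (elim conjE, assumption)+
  have "\<forall>u\<in>verts G. \<forall>v\<in>verts G. \<not> (u \<in> P \<and> v \<in> P) \<longrightarrow> \<not> (u \<in> K \<union> S \<and> v \<in> K \<union> S) \<longrightarrow>
      (adjacent G u v \<longleftrightarrow> u \<noteq> v \<and> u \<notin> S \<and> v \<notin> S)"
    using assms unfolding decomposition_def by (elim conjE)
  then show "adjacent G u v \<longleftrightarrow> u \<noteq> v \<and> u \<notin> S \<and> v \<notin> S"
    if "u \<in> verts G" "v \<in> verts G" "\<not> (u \<in> P \<and> v \<in> P)" "\<not> (u \<in> K \<union> S \<and> v \<in> K \<union> S)" for u v
    using that by blast
qed

lemma decomposition_card:
  assumes "decomposition Q G P Z K S"
  shows "card (verts G) = card (verts Q) + card Z + card (K \<union> S)"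
proof -
  note d = decompositionD[OF assms]
  have fin: "finite P" "finite Z" "finite (K \<union> S)"
    using d(1,2) by (auto simp: simple_graph_def)
  have "card (verts G) = card P + card Z + card (K \<union> S)"
    unfolding d(2) using fin d(3,4) by (simp add: card_Un_disjoint)
  moreover have "card P = card (verts Q)" using card_verts_iso[OF d(5)] by simp
  ultimately show ?thesis by simp
qed

text \<open>This recovers \<open>K\<close> from \<open>G\<close> and \<open>S\<close> alone: core
  and free vertices see nothing of \<open>S\<close>, \<open>S\<close> is stable, and each vertex of
  \<open>K\<close> has a neighbour in \<open>S\<close>.\<close>

lemma decomposition_smax_neighbours:
  assumes "decomposition Q G P Z K S"
  shows "{v \<in> verts G. \<exists>s\<in>S. adjacent G v s} = K"
proof -
  note d = decompositionD[OF assms]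
  have "\<not> adjacent G v s" if "v \<in> P \<union> Z" "s \<in> S" for v s
    using that d(4) d(2) d(7)[of v s] by auto
  then show ?thesis
    using d(2,6) unfolding smax_partition_def by blast
qed

lemma decomposition_split:
  assumes "decomposition Q G P Z K S"
  shows "split_graph (induced G (K \<union> S))"
  using decompositionD(6)[OF assms]
  unfolding split_graph_def smax_partition_def complete_graph_def edgeless_graph_def
  by (intro exI[of _ K] exI[of _ S]) simp

text \<open>The isomorphism is glued from three pieces: one between the cores, any bijection between
  the free vertices, and one between the split parts that respects their partitions. Equal orders
  force \<open>Z\<close> and \<open>Z'\<close> to have equal size.\<close>

lemma decomposition_iso:
  assumes dec: "decomposition Q G P Z K S" and dec': "decomposition Q G' P' Z' K' S'"
    and card: "card (verts G) = card (verts G')"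
    and iso: "isomorphic (induced G (K \<union> S)) (induced G' (K' \<union> S'))"
  shows "isomorphic G G'"
proof -
  note d = decompositionD[OF dec] and d' = decompositionD[OF dec']
  let ?L = "induced G (K \<union> S)" and ?L' = "induced G' (K' \<union> S')"
  have sm: "smax_partition (adjacent ?L) K S"
    using d(6) by (auto simp: smax_partition_def)
  have sm': "smax_partition (adjacent ?L') K' S'"
    using d'(6) by (auto simp: smax_partition_def)
  obtain h0 where h0: "graph_iso h0 ?L ?L'" using iso by (auto simp: isomorphic_iff)
  have v1: "verts ?L' = h0 ` K \<union> h0 ` S" using graph_iso_verts[OF h0] by (simp add: image_Un)
  have v2: "verts ?L' = K' \<union> S'" by simp
  have "smax_partition (adjacent ?L') (h0 ` K) (h0 ` S)"
    using smax_partition_image[OF h0 _ sm] by simp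
  then obtain t where t: "graph_iso t ?L' ?L'" "t ` h0 ` K = K'" "t ` h0 ` S = S'"
    using smax_partition_unique[OF v1 v2 _ sm'] by blast
  \<comment> \<open>The given \<open>h0\<close> may carry \<open>K\<close> and \<open>S\<close> to
    another partition of the second split part; \<open>t\<close> corrects this.\<close>
  define h where "h = t \<circ> h0"
  have h: "graph_iso h ?L ?L'" "h ` K = K'" "h ` S = S'"
    using graph_iso_comp[OF h0 t(1)] t(2,3) by (auto simp: h_def image_comp[symmetric])
  obtain p where p: "graph_iso p (induced G P) (induced G' P')"
    using d(5) d'(5) isomorphic_sym isomorphic_trans isomorphic_iff by metis
  have bij_p: "bij_betw p P P'" and bij_h: "bij_betw h (K \<union> S) (K' \<union> S')"
    using p h(1) by (simp_all add: graph_iso_def)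
  have "card (K \<union> S) = card (K' \<union> S')" using bij_h by (rule bij_betw_same_card)
  then have "card Z = card Z'"
    using decomposition_card[OF dec] decomposition_card[OF dec'] card by simp
  moreover have "finite Z" "finite Z'" using d(1,2) d'(1,2) by (auto simp: simple_graph_def)
  ultimately obtain z where bij_z: "bij_betw z Z Z'"
    using finite_same_card_bij by blast
  define g where "g v = (if v \<in> P then p v else if v \<in> Z then z v else h v)" for v
  have gP: "bij_betw g P P'"
    using bij_p by (rule bij_betw_cong[THEN iffD1, rotated]) (simp add: g_def)
  have gZ: "bij_betw g Z Z'"
    using bij_z by (rule bij_betw_cong[THEN iffD1, rotated]) (use d(3) in \<open>auto simp: g_def\<close>)
  have g_h: "g v = h v" if "v \<in> K \<union> S" for v
    using that d(4) by (auto simp: g_def)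
  have gKS: "bij_betw g (K \<union> S) (K' \<union> S')"
    using bij_h by (rule bij_betw_cong[THEN iffD1, rotated]) (simp add: g_h)
  have bij: "bij_betw g (verts G) (verts G')"
    unfolding d(2) d'(2) by (rule bij_betw_combine[OF bij_betw_combine[OF gP gZ d'(3)] gKS d'(4)])
  have inP: "g v \<in> P' \<longleftrightarrow> v \<in> P" and inKS: "g v \<in> K' \<union> S' \<longleftrightarrow> v \<in> K \<union> S" if v: "v \<in> verts G" for v
  proof -
    consider "v \<in> P" "v \<notin> K \<union> S" "g v \<in> P'" | "v \<in> Z" "v \<notin> P" "v \<notin> K \<union> S" "g v \<in> Z'"
      | "v \<in> K \<union> S" "v \<notin> P" "g v \<in> K' \<union> S'"
      using v d(2,3,4) gP gZ gKS unfolding bij_betw_def by blast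
    then have "(g v \<in> P' \<longleftrightarrow> v \<in> P) \<and> (g v \<in> K' \<union> S' \<longleftrightarrow> v \<in> K \<union> S)"
      by cases (use d'(3,4) in blast)+
    then show "g v \<in> P' \<longleftrightarrow> v \<in> P" "g v \<in> K' \<union> S' \<longleftrightarrow> v \<in> K \<union> S" by blast+
  qed
  have hS: "h v \<in> S' \<longleftrightarrow> v \<in> S" if "v \<in> K \<union> S" for v
  proof -
    have "K' \<inter> S' = {}" using d'(6) by (simp add: smax_partition_def)
    then show ?thesis using that h(2,3) by blast
  qed
  have inS: "g v \<in> S' \<longleftrightarrow> v \<in> S" if v: "v \<in> verts G" for v
  proof (cases "v \<in> K \<union> S")
    case True
    then show ?thesis using hS g_h by simp
  next
    case False
    then show ?thesis using inKS[OF v] by blast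
  qed
  have "adjacent G u v \<longleftrightarrow> adjacent G' (g u) (g v)" if uv: "u \<in> verts G" "v \<in> verts G" for u v
  proof -
    consider "u \<in> P" "v \<in> P" | "u \<in> K \<union> S" "v \<in> K \<union> S"
      | "\<not> (u \<in> P \<and> v \<in> P)" "\<not> (u \<in> K \<union> S \<and> v \<in> K \<union> S)" by blast
    then show ?thesis
    proof cases
      case 1
      then show ?thesis
        using graph_iso_adjacent[OF p, of u v] bij_betwE[OF bij_p] by (simp add: g_def)
    next
      case 2
      moreover from this have "h u \<in> K' \<union> S'" "h v \<in> K' \<union> S'" using bij_betwE[OF bij_h] by blast+
      ultimately show ?thesis
        using graph_iso_adjacent[OF h(1), of u v] by (simp add: g_h)
    next
      case 3
      \<comment> \<open>For such a pair adjacency depends only on equality and on membership in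
        \<open>S\<close>, both of which \<open>g\<close> preserves.\<close>
      have g: "g u \<in> verts G'" "g v \<in> verts G'" using uv bij_betwE[OF bij] by blast+
      have eq: "g u = g v \<longleftrightarrow> u = v"
        using uv bij unfolding bij_betw_def by (meson inj_on_eq_iff)
      have **: "\<not> (g u \<in> P' \<and> g v \<in> P')" "\<not> (g u \<in> K' \<union> S' \<and> g v \<in> K' \<union> S')"
        using 3 unfolding inP[OF uv(1)] inP[OF uv(2)] inKS[OF uv(1)] inKS[OF uv(2)] by blast+
      show ?thesis
        unfolding d(7)[OF uv 3] d'(7)[OF g **] inS[OF uv(1)] inS[OF uv(2)] eq ..
    qed
  qed
  with bij show ?thesis unfolding isomorphic_def by blast
qed

text \<open>The inverse construction: a core and free vertices are added to a normalised partition
  of \<open>H\<close>. The infinite vertex type supplies fresh vertices.\<close>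

lemma decomposition_exists:
  fixes H :: "'a sgraph" and Q :: "'b sgraph"
  assumes inf: "infinite (UNIV :: 'a set)" and H: "simple_graph H" "split_graph H"
    and Q: "simple_graph Q" and n: "card (verts H) + card (verts Q) \<le> n"
  obtains G :: "'a sgraph" and P Z K S where "decomposition Q G P Z K S" "card (verts G) = n"
    "isomorphic (induced G (K \<union> S)) H"
proof -
  obtain K S where V: "verts H = K \<union> S" and KS: "smax_partition (adjacent H) K S"
    using H by (rule smax_partition_exists)
  have finH: "finite (verts H)" using H(1) by (simp add: simple_graph_def)
  have "infinite (- verts H)" using inf finH by (metis Compl_eq_Diff_UNIV Diff_infinite_finite)
  then obtain P where P: "finite P" "card P = card (verts Q)" "P \<subseteq> - verts H"
    using infinite_arbitrarily_large by blast
  have "infinite (- verts H - P)" using P \<open>infinite (- verts H)\<close> by simp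
  \<comment> \<open>The free vertices fill the gap up to the order \<open>n\<close>; their number is
    the only remaining choice.\<close>
  then obtain Z where Z: "finite Z" "card Z = n - (card (verts H) + card (verts Q))"
    "Z \<subseteq> - verts H - P"
    using infinite_arbitrarily_large by blast
  obtain q where q: "bij_betw q P (verts Q)"
    using finite_same_card_bij[of P "verts Q"] P Q by (auto simp: simple_graph_def)
  define W where "W = P \<union> Z \<union> (K \<union> S)"
  define E where "E u v \<longleftrightarrow> (if u \<in> P \<and> v \<in> P then adjacent Q (q u) (q v)
    else if u \<in> K \<union> S \<and> v \<in> K \<union> S then adjacent H u v else u \<noteq> v \<and> u \<notin> S \<and> v \<notin> S)" for u v
  define G where "G = (W, {e. \<exists>u\<in>W. \<exists>v\<in>W. e = {u, v} \<and> E u v})"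
  have sym: "E u v \<longleftrightarrow> E v u" for u v
    by (auto simp: E_def adjacent_commute)
  have irr: "\<not> E u u" for u
    using simple_graph_adjacent(1)[OF H(1)] simple_graph_adjacent(1)[OF Q]
    by (auto simp: E_def)
  have adj: "adjacent G u v \<longleftrightarrow> u \<in> W \<and> v \<in> W \<and> E u v" for u v
    using sym by (auto simp: adjacent_def G_def doubleton_eq_iff)
  have VG: "verts G = W" by (simp add: G_def)
  have "finite W" using P Z finH V by (simp add: W_def)
  then have simpleG: "simple_graph G"
    using irr by (auto simp: simple_graph_def G_def card_insert_if)
  have disj: "P \<inter> Z = {}" "(P \<union> Z) \<inter> (K \<union> S) = {}" using P(3) Z(3) V by auto
  have adjKS: "adjacent G u v \<longleftrightarrow> adjacent H u v" if "u \<in> K \<union> S" "v \<in> K \<union> S" for u v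
    using that disj by (auto simp: adj E_def W_def)
  have "decomposition Q G P Z K S"
    unfolding decomposition_def
  proof (intro conjI ballI impI simpleG disj)
    show "verts G = P \<union> Z \<union> (K \<union> S)" by (simp add: VG W_def)
    have "graph_iso q (induced G P) Q"
      using q by (auto simp: graph_iso_def adj E_def W_def)
    then show "isomorphic (induced G P) Q" by (auto simp: isomorphic_iff)
    show "smax_partition (adjacent G) K S"
      using KS adjKS unfolding smax_partition_def by (metis UnCI)
    show "adjacent G u v \<longleftrightarrow> u \<noteq> v \<and> u \<notin> S \<and> v \<notin> S"
      if "u \<in> verts G" "v \<in> verts G" "\<not> (u \<in> P \<and> v \<in> P)" "\<not> (u \<in> K \<union> S \<and> v \<in> K \<union> S)" for u v
      using that by (simp only: adj VG E_def if_False simp_thms)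
  qed
  moreover from this have "card (verts G) = n"
    using decomposition_card Z(2) n V by fastforce
  moreover have "graph_iso id (induced G (K \<union> S)) H"
    using adjKS V by (simp add: graph_iso_def)
  then have "isomorphic (induced G (K \<union> S)) H" unfolding isomorphic_iff by blast
  ultimately show ?thesis using that by blast
qed

text \<open>The hypothesis on \<open>C_part\<close> makes the split part readable from
  \<open>G\<close> without choosing a decomposition, so taking it respects isomorphism. Injectivity
  then comes from \<open>decomposition_iso\<close>, surjectivity from
  \<open>decomposition_exists\<close>.\<close>

lemma decomposition_quotient_bij:
  fixes Q :: "'b sgraph"
  defines "X n \<equiv> {G :: nat sgraph. (\<exists>P Z K S. decomposition Q G P Z K S) \<and> card (verts G) = n}"
  assumes Q: "simple_graph Q"
    and C: "\<And>(G :: nat sgraph) P Z K S. decomposition Q G P Z K S \<Longrightarrow> C_part G = S"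
  shows "\<exists>f. bij_betw f (X n // iso_rel) (Split_upto (int n - int (card (verts Q))))"
proof -
  \<comment> \<open>Neighbours of C are collected instead of all of B, because with the 5-cycle core
    B also contains the free vertices.\<close>
  define N where "N G = {v \<in> verts G. \<exists>s\<in>C_part G. adjacent G v s} \<union> C_part G" for G :: "nat sgraph"
  have N: "N G = K \<union> S" if "decomposition Q G P Z K S" for G P Z K S
    using C[OF that] decomposition_smax_neighbours[OF that] by (simp add: N_def)
  have simpleX: "simple_graph G" if "G \<in> X n" for G
    using that by (auto simp: X_def dest: decompositionD(1))
  have NV: "N G \<subseteq> verts G" for G
    by (auto simp: N_def C_part_def)
  have N_iso: "isomorphic (induced G (N G)) (induced G' (N G'))" if iso: "isomorphic G G'" for G G'
  proof -
    obtain f where f: "graph_iso f G G'" using iso by (auto simp: isomorphic_iff)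
    have CV: "C_part G \<subseteq> verts G" by (auto simp: C_part_def)
    have "{v \<in> verts G'. \<exists>s\<in>C_part G'. adjacent G' v s}
        = f ` {v \<in> verts G. \<exists>s\<in>C_part G. adjacent G v s}"
      using CV graph_iso_adjacent[OF f] unfolding C_part_iso[OF f] graph_iso_verts[OF f] by blast
    then have "N G' = f ` N G"
      by (simp add: N_def C_part_iso[OF f] image_Un)
    with induced_iso[OF f NV] show ?thesis by (auto simp: isomorphic_iff)
  qed
  let ?Y = "{H :: nat sgraph. simple_graph H \<and> split_graph H \<and> card (verts H) + card (verts Q) \<le> n}"
  have "\<exists>f. bij_betw f (X n // iso_rel) (?Y // iso_rel)"
  proof (rule quotient_bij[OF equiv_iso_rel, where F = "\<lambda>G. induced G (N G)"])
    show "X n \<subseteq> {G. simple_graph G}" "?Y \<subseteq> {G. simple_graph G}" using simpleX by auto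
    show "(\<lambda>G. induced G (N G)) ` X n \<subseteq> ?Y"
    proof (rule image_subsetI)
      fix G assume G: "G \<in> X n"
      then obtain P Z K S where dec: "decomposition Q G P Z K S" and c: "card (verts G) = n"
        by (auto simp: X_def)
      have "simple_graph (induced G (N G))"
        using simpleX[OF G] NV by (rule simple_graph_induced)
      then show "induced G (N G) \<in> ?Y"
        using decomposition_split[OF dec] decomposition_card[OF dec] c by (simp add: N[OF dec])
    qed
    show "(induced G (N G), induced G' (N G')) \<in> iso_rel \<longleftrightarrow> (G, G') \<in> iso_rel"
      if G: "G \<in> X n" and G': "G' \<in> X n" for G G'
    proof -
      obtain P Z K S where dec: "decomposition Q G P Z K S" and c: "card (verts G) = n"
        using G by (auto simp: X_def)
      obtain P' Z' K' S' where dec': "decomposition Q G' P' Z' K' S'" and c': "card (verts G') = n"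
        using G' by (auto simp: X_def)
      have "isomorphic G G'" if "isomorphic (induced G (N G)) (induced G' (N G'))"
        using decomposition_iso[OF dec dec'] that c c' by (simp add: N[OF dec] N[OF dec'])
      then have "isomorphic (induced G (N G)) (induced G' (N G')) \<longleftrightarrow> isomorphic G G'"
        using N_iso by blast
      then show ?thesis
        using simpleX[OF G] simpleX[OF G'] simple_graph_induced[OF simpleX[OF G] NV]
          simple_graph_induced[OF simpleX[OF G'] NV] by (simp add: iso_rel_def)
    qed
    show "\<exists>G\<in>X n. (induced G (N G), H) \<in> iso_rel" if H: "H \<in> ?Y" for H
    proof -
      obtain G :: "nat sgraph" and P Z K S where dec: "decomposition Q G P Z K S" and c: "card (verts G) = n"
        and iso: "isomorphic (induced G (K \<union> S)) H"
        using decomposition_exists[OF infinite_UNIV_nat _ _ Q] H by blast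
      have G: "G \<in> X n" using dec c by (auto simp: X_def)
      moreover have "(induced G (N G), H) \<in> iso_rel"
        using iso H simple_graph_induced[OF simpleX[OF G] NV] by (simp add: iso_rel_def N[OF dec])
      ultimately show ?thesis by blast
    qed
  qed
  then show ?thesis by (simp only: Split_upto_eq)
qed

section \<open>The core of an NG-graph\<close>

text \<open>The condition on A serves both cores: \<open>P\<close> is an edge of a clique A, or all
  of A, where the condition is vacuous. The rest of A and the vertices of B that see nothing of C
  behave alike: they are joined to every other vertex outside C. So both go into the free
  part.\<close>

lemma NG_decomposition:
  assumes G: "simple_graph G" "NG_graph G"
    and P: "P \<subseteq> A_part G" "isomorphic (induced G P) Q"
    and A: "\<And>u v. u \<in> A_part G \<Longrightarrow> v \<in> A_part G \<Longrightarrow> u \<noteq> v \<Longrightarrow> \<not> (u \<in> P \<and> v \<in> P) \<Longrightarrow> adjacent G u v"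
  defines "K \<equiv> {b \<in> B_part G. \<exists>c\<in>C_part G. adjacent G b c}"
  shows "decomposition Q G P ((A_part G - P) \<union> (B_part G - K)) K (C_part G)"
proof -
  let ?A = "A_part G" and ?B = "B_part G" and ?C = "C_part G"
  note ABC = ABC_partition[of G]
  note low = NG_graph_structure(1)[OF G] and high = NG_graph_structure(2)[OF G]
  have KB: "K \<subseteq> ?B" by (auto simp: K_def)
  show ?thesis
    unfolding decomposition_def
  proof (intro conjI ballI impI)
    show "simple_graph G" by (rule G)
    show "isomorphic (induced G P) Q" by (rule P)
    show "verts G = P \<union> (?A - P \<union> (?B - K)) \<union> (K \<union> ?C)"
      unfolding ABC(1) using P(1) KB by blast
    show "P \<inter> (?A - P \<union> (?B - K)) = {}" using P(1) ABC(2) by blast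
    show "(P \<union> (?A - P \<union> (?B - K))) \<inter> (K \<union> ?C) = {}" using P(1) KB ABC(2-4) by blast
    show "smax_partition (adjacent G) K ?C"
      unfolding smax_partition_def
    proof (intro conjI ballI impI)
      show "K \<inter> ?C = {}" using KB ABC(4) by blast
      show "adjacent G u v" if "u \<in> K" "v \<in> K" "u \<noteq> v" for u v using that KB high by blast
      show "\<not> adjacent G u v" if "u \<in> ?C" "v \<in> ?C" for u v using that low by blast
      show "\<exists>s\<in>?C. adjacent G u s" if "u \<in> K" for u using that by (simp add: K_def)
    qed
    fix u v
    assume uv: "u \<in> verts G" "v \<in> verts G" and nP: "\<not> (u \<in> P \<and> v \<in> P)"
      and nKS: "\<not> (u \<in> K \<union> ?C \<and> v \<in> K \<union> ?C)"
    \<comment> \<open>As \<open>u\<close> and \<open>v\<close> are not both in the split part, an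
      edge with one end in C would have its other end outside it.\<close>
    have nC: "\<not> adjacent G x c" if "c \<in> ?C" "x \<in> verts G" "x \<notin> K \<union> ?C" for x c
    proof (cases "x \<in> ?B")
      case True
      then show ?thesis using that by (auto simp: K_def)
    next
      case False
      then have "x \<in> ?A" using that ABC(1) by blast
      then show ?thesis using low[of c x] that(1) adjacent_commute[of G c x] by blast
    qed
    show "adjacent G u v \<longleftrightarrow> u \<noteq> v \<and> u \<notin> ?C \<and> v \<notin> ?C"
    proof
      assume adj: "adjacent G u v"
      have "u \<noteq> v" using simple_graph_adjacent(1)[OF G(1) adj] .
      moreover have "u \<notin> ?C"
        using nC[of u v] adj uv(2) nKS adjacent_commute[of G u v] by blast
      moreover have "v \<notin> ?C"
        using nC[of v u] adj uv(1) nKS by blast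
      ultimately show "u \<noteq> v \<and> u \<notin> ?C \<and> v \<notin> ?C" by blast
    next
      assume neq: "u \<noteq> v \<and> u \<notin> ?C \<and> v \<notin> ?C"
      then consider "u \<in> ?A" "v \<in> ?A" | "u \<in> ?B" "v \<in> ?A \<union> ?B" | "v \<in> ?B" "u \<in> ?A \<union> ?B"
        using uv ABC(1) by blast
      then show "adjacent G u v"
      proof cases
        case 1
        then show ?thesis using A nP neq by blast
      next
        case 2
        then show ?thesis using high neq by blast
      next
        case 3
        then have "adjacent G v u" using high neq by blast
        then show ?thesis by (simp add: adjacent_commute)
      qed
    qed
  qed
qed

text \<open>\<open>Y\<close> is the share of the free vertices that belongs to A, \<open>L\<close>
  the share that belongs to B. Vertices of \<open>L\<close> have no neighbour in \<open>S\<close>,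
  so they reach high degree only if \<open>P \<union> Y\<close> needs fewer colours than it has
  vertices.\<close>

lemma decomposition_NG:
  assumes dec: "decomposition Q G P Z K S"
    and Z: "Z = Y \<union> L" "Y \<inter> L = {}" and "P \<noteq> {}"
    and NG: "chi (P \<union> Y) (adjacent G) + chi (P \<union> Y) (\<lambda>u v. \<not> adjacent G u v) = card (P \<union> Y) + 1"
    and regular: "\<And>v. v \<in> P \<union> Y \<Longrightarrow> deg (P \<union> Y) (adjacent G) v + 1 = chi (P \<union> Y) (adjacent G)"
    and ge2: "2 \<le> chi (P \<union> Y) (adjacent G)"
    and L: "L = {} \<or> chi (P \<union> Y) (adjacent G) < card (P \<union> Y)"
  shows "NG_graph G" "A_part G = P \<union> Y" "C_part G = S"
proof -
  note d = decompositionD[OF dec]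
  have sm: "K \<inter> S = {}" "\<And>u v. u \<in> K \<Longrightarrow> v \<in> K \<Longrightarrow> u \<noteq> v \<Longrightarrow> adjacent G u v"
    "\<And>u v. u \<in> S \<Longrightarrow> v \<in> S \<Longrightarrow> \<not> adjacent G u v" "\<And>u. u \<in> K \<Longrightarrow> \<exists>s\<in>S. adjacent G u s"
    using d(6) unfolding smax_partition_def by simp_all
  have V: "verts G = (P \<union> Y) \<union> (L \<union> K) \<union> S" unfolding d(2) Z(1) by blast
  have mixed: "adjacent G u v \<longleftrightarrow> u \<noteq> v \<and> v \<notin> S"
    if "u \<in> Z \<and> v \<in> verts G \<or> u \<in> P \<and> v \<in> Z \<union> K \<union> S" for u v
  proof -
    have "u \<in> verts G" "v \<in> verts G" "\<not> (u \<in> P \<and> v \<in> P)" "\<not> (u \<in> K \<union> S \<and> v \<in> K \<union> S)" "u \<notin> S"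
      using that d(2-4) by blast+
    then show ?thesis using d(7)[of u v] by simp
  qed
  have LK: "adjacent G u v" if "u \<in> L \<union> K" "v \<in> L \<union> K" "u \<noteq> v" for u v
  proof -
    have "v \<in> verts G" "u \<in> verts G" "u \<notin> S" "v \<notin> S" using that d(2,4) sm(1) Z(1) by blast+
    then show ?thesis
      using mixed[of u v] mixed[of v u] sm(2)[of u v] that Z(1) adjacent_commute[of G u v] by blast
  qed
  have PLK: "adjacent G u v" if "u \<in> P \<union> Y" "v \<in> L \<union> K" for u v
  proof -
    have "u \<noteq> v" "v \<notin> S" "v \<in> verts G" using that d(2-4) sm(1) Z by blast+
    then show ?thesis using mixed[of u v] that Z(1) by blast
  qed
  have PS: "\<not> adjacent G u v" if "u \<in> P \<union> Y" "v \<in> S" for u v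
    using mixed[of u v] that Z(1) d(2) by blast
  have disj: "(P \<union> Y) \<inter> (L \<union> K) = {}" "(P \<union> Y) \<inter> S = {}" "(L \<union> K) \<inter> S = {}"
    using d(3,4) Z sm(1) by blast+
  have ne: "P \<union> Y \<noteq> {}" using \<open>P \<noteq> {}\<close> by blast
  have up: "chi (P \<union> Y) (adjacent G) < card (P \<union> Y) \<or> (\<exists>s\<in>S. adjacent G v s)" if "v \<in> L \<union> K" for v
    using that L sm(4) by blast
  show "NG_graph G" "A_part G = P \<union> Y" "C_part G = S"
    using NG_blowup[OF d(1) V disj ne LK sm(3) PLK PS NG regular ge2 up] by blast+
qed

section \<open>The two cores: a single edge and the 5-cycle\<close>

definition K2 :: "nat sgraph" where
  "K2 = ({0, 1}, {{0, 1}})"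

lemma simple_K2: "simple_graph K2"
  by (auto simp: simple_graph_def K2_def)

lemma isomorphic_K2_iff:
  assumes "simple_graph G"
  shows "isomorphic (induced G P) K2 \<longleftrightarrow> (\<exists>a b. P = {a, b} \<and> adjacent G a b)"
proof
  assume "isomorphic (induced G P) K2"
  then obtain f where f: "graph_iso f K2 (induced G P)"
    using isomorphic_sym isomorphic_iff by metis
  have "P = {f 0, f 1}" using graph_iso_verts[OF f] by (simp add: K2_def)
  moreover have "adjacent (induced G P) (f 0) (f 1)"
    using graph_iso_adjacent[OF f, of 0 1] by (simp add: K2_def adjacent_def)
  ultimately show "\<exists>a b. P = {a, b} \<and> adjacent G a b" by auto
next
  assume "\<exists>a b. P = {a, b} \<and> adjacent G a b"
  then obtain a b where P: "P = {a, b}" and ab: "adjacent G a b" by blast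
  have neq: "a \<noteq> b" using simple_graph_adjacent(1)[OF assms ab] .
  have loop: "\<not> adjacent G v v" for v using simple_graph_adjacent(1)[OF assms] by blast
  let ?f = "\<lambda>v. if v = a then 0 else 1 :: nat"
  have "bij_betw ?f {a, b} {0, 1}" using neq by (auto simp: bij_betw_def inj_on_def)
  moreover have "adjacent K2 0 1" "adjacent K2 1 0" "\<not> adjacent K2 0 0" "\<not> adjacent K2 1 1"
    by (auto simp: K2_def adjacent_def)
  moreover have "adjacent G b a" using ab by (simp add: adjacent_commute[of G b a])
  moreover have "verts K2 = {0, 1}" by (simp add: K2_def)
  ultimately have "graph_iso ?f (induced G P) K2"
    unfolding graph_iso_def P using neq ab loop by simp
  then show "isomorphic (induced G P) K2" unfolding isomorphic_iff by blast
qed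

lemma decomposition_K2:
  assumes "decomposition K2 G P Z K S"
  shows "NG_graph G" "A_part G = P \<union> Z" "C_part G = S"
    "complete_graph (induced G (A_part G))" "\<not> edgeless_graph (induced G (A_part G))"
proof -
  note d = decompositionD[OF assms]
  obtain a b where P: "P = {a, b}" and ab: "adjacent G a b"
    using d(5) isomorphic_K2_iff[OF d(1)] by blast
  have neq: "a \<noteq> b" using simple_graph_adjacent(1)[OF d(1) ab] .
  have clique: "adjacent G u v" if "u \<in> P \<union> Z" "v \<in> P \<union> Z" "u \<noteq> v" for u v
  proof (cases "u \<in> P \<and> v \<in> P")
    case True
    then show ?thesis using P ab that(3) adjacent_commute[of G a b] by blast
  next
    case False
    have "u \<in> verts G" "v \<in> verts G" "u \<notin> S" "v \<notin> S" "\<not> (u \<in> K \<union> S \<and> v \<in> K \<union> S)"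
      using that d(2,4) by blast+
    then show ?thesis using d(7)[of u v] False that(3) by blast
  qed
  have fin: "finite (P \<union> Z)" using d(1,2) by (simp add: simple_graph_def)
  have chi: "chi (P \<union> Z) (adjacent G) = card (P \<union> Z)"
    using fin clique by (rule chi_clique)
  have chi': "chi (P \<union> Z) (\<lambda>u v. \<not> adjacent G u v) = 1"
    using fin clique P by (intro chi_stable) auto
  have "card P \<le> card (P \<union> Z)" using fin by (intro card_mono) auto
  then have card: "2 \<le> card (P \<union> Z)" using P neq by simp
  have deg: "deg (P \<union> Z) (adjacent G) v + 1 = card (P \<union> Z)" if v: "v \<in> P \<union> Z" for v
  proof -
    have "{u \<in> P \<union> Z. u \<noteq> v \<and> adjacent G u v} = P \<union> Z - {v}" using clique v by blast
    then show ?thesis using card_Suc_Diff1[OF fin v] by (simp add: deg_def)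
  qed
  \<comment> \<open>All free vertices go to A (\<open>Y = Z\<close>, \<open>L = {}\<close>): a
    clique leaves no gap between chromatic number and order.\<close>
  have Z: "Z = Z \<union> {}" "Z \<inter> {} = {}" "P \<noteq> {}" using P by auto
  note NG = decomposition_NG[OF assms Z]
  show "NG_graph G" and A: "A_part G = P \<union> Z" and "C_part G = S"
    using NG chi chi' card deg by simp_all
  show "complete_graph (induced G (A_part G))"
    unfolding A using clique by (auto simp: complete_graph_def)
  show "\<not> edgeless_graph (induced G (A_part G))"
    unfolding A edgeless_graph_def using ab P by auto
qed

text \<open>A clique that is not edgeless contains an edge, and any edge of G[A] can serve as the
  core, since the other vertices of A are joined to both ends.\<close>

lemma NG_clique_iff:
  "simple_graph G \<and> NG_graph G \<and> complete_graph (induced G (A_part G)) \<and>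
     \<not> edgeless_graph (induced G (A_part G)) \<longleftrightarrow> (\<exists>P Z K S. decomposition K2 G P Z K S)"
proof
  assume G: "simple_graph G \<and> NG_graph G \<and> complete_graph (induced G (A_part G)) \<and>
     \<not> edgeless_graph (induced G (A_part G))"
  then obtain a b where ab: "a \<in> A_part G" "b \<in> A_part G" "adjacent G a b"
    by (auto simp: edgeless_graph_def)
  have "isomorphic (induced G {a, b}) K2" using isomorphic_K2_iff ab(3) G by blast
  moreover have "adjacent G u v" if "u \<in> A_part G" "v \<in> A_part G" "u \<noteq> v" for u v
    using that G by (auto simp: complete_graph_def)
  ultimately show "\<exists>P Z K S. decomposition K2 G P Z K S"
    using NG_decomposition[of G "{a, b}" K2] G ab by blast
next
  assume "\<exists>P Z K S. decomposition K2 G P Z K S"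
  then obtain P Z K S where dec: "decomposition K2 G P Z K S" by blast
  show "simple_graph G \<and> NG_graph G \<and> complete_graph (induced G (A_part G)) \<and>
     \<not> edgeless_graph (induced G (A_part G))"
    using decompositionD(1)[OF dec] decomposition_K2(1,4,5)[OF dec] by blast
qed

lemma decomposition_cycle5:
  assumes "decomposition (cycle_graph 5) G P Z K S"
  shows "NG_graph G" "A_part G = P" "C_part G = S"
proof -
  note d = decompositionD[OF assms]
  let ?H = "induced G P"
  have PV: "P \<subseteq> verts G" using d(2) by blast
  have H: "simple_graph ?H" using d(1) PV by (rule simple_graph_induced)
  have "chi P (adjacent G) = chi P (adjacent ?H)" by (rule chi_cong) simp
  also have "\<dots> = 3"
    using chromatic_number_chi[OF H] chromatic_number_iso[OF d(5)] chromatic_number_cycle5 by simp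
  finally have chi: "chi P (adjacent G) = 3" .
  have "chi P (\<lambda>u v. \<not> adjacent G u v) = chi P (\<lambda>u v. \<not> adjacent ?H u v)" by (rule chi_cong) simp
  also have "\<dots> = 3"
    using chromatic_number_complement[OF H] chromatic_number_iso[OF complement_iso[OF d(5)]]
      chromatic_number_iso[OF cycle5_self_complementary] chromatic_number_cycle5 by simp
  finally have chi': "chi P (\<lambda>u v. \<not> adjacent G u v) = 3" .
  have card: "card P = 5" using card_verts_iso[OF d(5)] by (simp add: cycle_graph_def)
  have deg: "deg P (adjacent G) v = 2" if v: "v \<in> P" for v
  proof -
    obtain f where f: "graph_iso f ?H (cycle_graph 5)" using d(5) by (auto simp: isomorphic_iff)
    have "f v < 5" using graph_iso_verts[OF f] v by (auto simp: cycle_graph_def)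
    then have "vdegree ?H v = 2" using vdegree_iso[OF f, of v] v vdegree_cycle5[of "f v"] by simp
    moreover have "deg P (adjacent G) v = deg P (adjacent ?H) v"
      by (rule deg_cong) (simp add: v)
    ultimately show ?thesis using vdegree_deg[OF H] by simp
  qed
  \<comment> \<open>All free vertices go to B (\<open>Y = {}\<close>, \<open>L = Z\<close>), which
    the gap between 3 and 5 permits.\<close>
  have Z: "Z = {} \<union> Z" "{} \<inter> Z = {}" "P \<noteq> {}" using card by auto
  have NG: "chi P (adjacent G) + chi P (\<lambda>u v. \<not> adjacent G u v) = card P + 1"
    using chi chi' card by simp
  have regular: "deg P (adjacent G) v + 1 = chi P (adjacent G)" if "v \<in> P" for v
    using deg[OF that] chi by simp
  have bounds: "2 \<le> chi P (adjacent G)" "Z = {} \<or> chi P (adjacent G) < card P"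
    using chi card by simp_all
  note concl = decomposition_NG[OF assms Z, unfolded Un_empty_right, OF NG regular bounds]
  show "NG_graph G" by (rule concl(1))
  show "A_part G = P" by (rule concl(2))
  show "C_part G = S" by (rule concl(3))
qed

lemma NG_cycle5_iff:
  "simple_graph G \<and> NG_graph G \<and> isomorphic (induced G (A_part G)) (cycle_graph 5)
     \<longleftrightarrow> (\<exists>P Z K S. decomposition (cycle_graph 5) G P Z K S)"
proof
  assume G: "simple_graph G \<and> NG_graph G \<and> isomorphic (induced G (A_part G)) (cycle_graph 5)"
  then show "\<exists>P Z K S. decomposition (cycle_graph 5) G P Z K S"
    using NG_decomposition[of G "A_part G" "cycle_graph 5"] by blast
next
  assume "\<exists>P Z K S. decomposition (cycle_graph 5) G P Z K S"
  then obtain P Z K S where dec: "decomposition (cycle_graph 5) G P Z K S" by blast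
  show "simple_graph G \<and> NG_graph G \<and> isomorphic (induced G (A_part G)) (cycle_graph 5)"
    using decompositionD(1,5)[OF dec] decomposition_cycle5(1,2)[OF dec] by simp
qed

section \<open>The two classes as quotients, and the bijections\<close>

text \<open>The difference is one of sets of classes. It becomes a condition on representatives
  because edgelessness of G[A] is invariant under isomorphism, so no member of a class in
  \<open>NG2\<close> can violate it.\<close>

lemma NG1_minus_NG2:
  "NG1 - NG2 = {G. \<exists>P Z K S. decomposition K2 G P Z K S} // iso_rel"
proof -
  define P where "P G \<longleftrightarrow> simple_graph G \<and> NG_graph G \<and> complete_graph (induced G (A_part G))"
    for G :: "nat sgraph"
  have edgeless: "edgeless_graph (induced G (A_part G))"
    if "isomorphic G H" "edgeless_graph (induced H (A_part H))" for G H :: "nat sgraph"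
  proof -
    obtain f where f: "graph_iso f G H" using \<open>isomorphic G H\<close> by (auto simp: isomorphic_iff)
    have "A_part G \<subseteq> verts G" by (auto simp: A_part_def)
    then have "isomorphic (induced G (A_part G)) (induced H (A_part H))"
      using induced_iso[OF f] A_part_iso[OF f] isomorphic_iff by metis
    then show ?thesis using that(2) by (rule edgeless_graph_iso)
  qed
  have NG2: "iso_rel `` {G} \<in> NG2 \<longleftrightarrow> edgeless_graph (induced G (A_part G))" if "P G" for G
  proof
    assume "iso_rel `` {G} \<in> NG2"
    then obtain H where H: "simple_graph H" "edgeless_graph (induced H (A_part H))"
      "iso_rel `` {G} = iso_rel `` {H}"
      by (auto simp: NG2_def unlabeled_def elim!: quotientE)
    then have "isomorphic G H" using iso_class_eq_iff that by (simp add: P_def)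
    with H(2) show "edgeless_graph (induced G (A_part G))" using edgeless by blast
  next
    assume "edgeless_graph (induced G (A_part G))"
    then show "iso_rel `` {G} \<in> NG2"
      using that by (auto simp: NG2_def unlabeled_def P_def intro!: quotientI)
  qed
  have "NG1 = {G. P G} // iso_rel" by (simp add: NG1_def unlabeled_def P_def)
  then have "c \<in> NG1 \<longleftrightarrow> (\<exists>G. P G \<and> c = iso_rel `` {G})" for c
    unfolding quotient_def by blast
  then have "c \<in> NG1 - NG2 \<longleftrightarrow> (\<exists>G. P G \<and> \<not> edgeless_graph (induced G (A_part G)) \<and> c = iso_rel `` {G})" for c
    unfolding Diff_iff using NG2 by metis
  then have "c \<in> NG1 - NG2 \<longleftrightarrow> c \<in> {G. P G \<and> \<not> edgeless_graph (induced G (A_part G))} // iso_rel" for c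
    unfolding quotient_def by blast
  then have "NG1 - NG2 = {G. P G \<and> \<not> edgeless_graph (induced G (A_part G))} // iso_rel"
    by (rule set_eqI)
  then show ?thesis by (simp add: P_def NG_clique_iff[symmetric])
qed

lemma NG3_eq: "NG3 = {G. \<exists>P Z K S. decomposition (cycle_graph 5) G P Z K S} // iso_rel"
  by (simp add: NG3_def unlabeled_def NG_cycle5_iff)

theorem theorem4p5:
  fixes n :: nat
  assumes "n > 0"
  shows "(\<exists>f. bij_betw f (of_order (NG1 - NG2) n) (Split_upto (int n - 2))) \<and>
         (\<exists>g. bij_betw g (of_order NG3 n) (Split_upto (int n - 5)))"
proof
  have simple: "\<exists>P Z K S. decomposition Q G P Z K S \<Longrightarrow> simple_graph G" for Q G :: "nat sgraph"
    using decompositionD(1) by blast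
  have "card (verts K2) = 2" by (simp add: K2_def)
  then show "\<exists>f. bij_betw f (of_order (NG1 - NG2) n) (Split_upto (int n - 2))"
    using decomposition_quotient_bij[OF simple_K2 decomposition_K2(3), where n = n]
    by (simp add: NG1_minus_NG2 of_order_quotient[OF simple])
  have "card (verts (cycle_graph 5)) = 5" by (simp add: cycle_graph_def)
  then show "\<exists>g. bij_betw g (of_order NG3 n) (Split_upto (int n - 5))"
    using decomposition_quotient_bij[OF simple_cycle5 decomposition_cycle5(3), where n = n]
    by (simp add: NG3_eq of_order_quotient[OF simple])
qed

end
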